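(* There exists a constant $d^*>1$ such that for all $1<d<d^*$, the hard-core model with fugacity $\lambda=+\infty$ on a random $\mathrm{Poisson}(d)$ tree $T$ exhibits WSM but not SSM, almost surely conditioned on $T$ being infinite. Furthermore, the largest such $d^*$ is at least $e^{1/\sqrt2}/\sqrt2=1.434\ldots$ and at most $e=2.718\ldots$.
   Context: Poisson tree: for $d>0$, $\mathrm{Poisson}(d)$ denotes the random rooted tree in which every vertex independently has a random number of children with distribution $\Pr(X=i)=e^{-d}d^i/i!$, $i\ge 0$ (the Galton–Watson tree with Poisson offspring of mean $d$). Hard-core model with fugacity $\lambda=+\infty$ on a graph $G$ (locally finite): configurations are independent sets of $G$ (each vertex is "occupied" or "unoccupied", no two adjacent vertices are occupied). For a finite vertex set $\Psi$, let $\partial\Psi=\{v\in\Psi : v \text{ has a neighbor not in } \Psi\}$. For a boundary condition $\sigma$ on $\partial\Psi$ (an assignment of occupied/unoccupied with no two adjacent occupied vertices), $\mu_\Psi^\sigma$ is the uniform distribution over those independent sets of the subgraph induced by $\Psi$ that agree with $\sigma$ on $\partial\Psi$ and have maximum possible size among independent sets agreeing with $\sigma$ on $\partial\Psi$. Weak spatial mixing (WSM): for every finite vertex set $\Lambda$, and every sequence of triples $(\Psi_n,\sigma_n,\tau_n)$ with $\Psi_n\supset\Lambda$ finite and $\sigma_n,\tau_n$ boundary conditions on $\partial\Psi_n$, if $\mathrm{dist}(\Lambda,\partial\Psi_n)\to\infty$ then $\|\mu_{\Psi_n}^{\sigma_n}-\mu_{\Psi_n}^{\tau_n}\|_\Lambda\to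 0$, where $\|\cdot\|_\Lambda$ is the total variation distance between the marginals on $\Lambda$ (distance to the empty set is $+\infty$). WSM is equivalent to uniqueness of the Gibbs measure. Strong spatial mixing (SSM): the analogous property in which only the set of vertices on which the two boundary conditions disagree is required to be at distance tending to infinity from $\Lambda$ (nearer vertices may be frozen identically in both). For independent sets this is taken in the equivalent form: SSM holds on $G$ if and only if WSM holds for the hard-core model (with the same fugacity) on every subgraph of $G$. *)

theory Defs
  imports "HOL-Probability.Probability"
begin

text \<open>
  A graph is a vertex set \<open>V\<close> together with a symmetric irreflexive
  adjacency relation \<open>E \<subseteq> V \<times> V\<close>; it may be infinite.
\<close>

definition simple_graph :: "'a set \<Rightarrow> ('a \<times> 'a) set \<Rightarrow> bool" where
  "simple_graph V E \<longleftrightarrow> E \<subseteq> V \<times> V \<and> sym E \<and> irrefl E"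

text \<open>Subgraphs are not required to be induced.\<close>

definition is_subgraph :: "'a set \<Rightarrow> ('a \<times> 'a) set \<Rightarrow> 'a set \<Rightarrow> ('a \<times> 'a) set \<Rightarrow> bool" where
  "is_subgraph V' E' V E \<longleftrightarrow> simple_graph V' E' \<and> V' \<subseteq> V \<and> E' \<subseteq> E"

definition set_gdist :: "('a \<times> 'a) set \<Rightarrow> 'a set \<Rightarrow> 'a set \<Rightarrow> enat" where
  "set_gdist E A B = (INF n \<in> {n. \<exists>x\<in>A. \<exists>y\<in>B. (x, y) \<in> E ^^ n}. enat n)"

definition indep :: "('a \<times> 'a) set \<Rightarrow> 'a set \<Rightarrow> bool" where
  "indep E I \<longleftrightarrow> (\<forall>x\<in>I. \<forall>y\<in>I. (x, y) \<notin> E)"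

definition boundary :: "('a \<times> 'a) set \<Rightarrow> 'a set \<Rightarrow> 'a set" where
  "boundary E \<Psi> = {v \<in> \<Psi>. \<exists>w. (v, w) \<in> E \<and> w \<notin> \<Psi>}"

text \<open>Configurations and boundary conditions are encoded by their sets of occupied vertices.\<close>

definition boundary_condition :: "('a \<times> 'a) set \<Rightarrow> 'a set \<Rightarrow> 'a set \<Rightarrow> bool" where
  "boundary_condition E \<Psi> \<sigma> \<longleftrightarrow> \<sigma> \<subseteq> boundary E \<Psi> \<and> indep E \<sigma>"

definition hc_configs :: "('a \<times> 'a) set \<Rightarrow> 'a set \<Rightarrow> 'a set \<Rightarrow> 'a set set" where
  "hc_configs E \<Psi> \<sigma> = {I. I \<subseteq> \<Psi> \<and> indep E I \<and> I \<inter> boundary E \<Psi> = \<sigma>}"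

definition hc_max_configs :: "('a \<times> 'a) set \<Rightarrow> 'a set \<Rightarrow> 'a set \<Rightarrow> 'a set set" where
  "hc_max_configs E \<Psi> \<sigma> =
     {I \<in> hc_configs E \<Psi> \<sigma>. \<forall>J \<in> hc_configs E \<Psi> \<sigma>. card J \<le> card I}"

text \<open>
  For finite \<open>\<Psi>\<close> and a boundary condition \<open>\<sigma>\<close> the set of maximum configurations is finite,
  and it is nonempty because \<open>\<sigma>\<close> itself is a configuration, so \<open>pmf_of_set\<close> is meaningful.
\<close>

definition hc_measure :: "('a \<times> 'a) set \<Rightarrow> 'a set \<Rightarrow> 'a set \<Rightarrow> 'a set pmf" where
  "hc_measure E \<Psi> \<sigma> = pmf_of_set (hc_max_configs E \<Psi> \<sigma>)"

definition tv_dist :: "'b pmf \<Rightarrow> 'b pmf \<Rightarrow> real" where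
  "tv_dist p q = (SUP A. \<bar>measure_pmf.prob p A - measure_pmf.prob q A\<bar>)"

definition marginal :: "'a set \<Rightarrow> 'a set pmf \<Rightarrow> 'a set pmf" where
  "marginal \<Lambda> p = map_pmf (\<lambda>I. I \<inter> \<Lambda>) p"

definition WSM :: "'a set \<Rightarrow> ('a \<times> 'a) set \<Rightarrow> bool" where
  "WSM V E \<longleftrightarrow>
     (\<forall>\<Lambda>. finite \<Lambda> \<and> \<Lambda> \<subseteq> V \<longrightarrow>
       (\<forall>(\<Psi> :: nat \<Rightarrow> 'a set) \<sigma> \<tau>.
          (\<forall>n. finite (\<Psi> n) \<and> \<Psi> n \<subseteq> V \<and> \<Lambda> \<subseteq> \<Psi> n \<and>
               boundary_condition E (\<Psi> n) (\<sigma> n) \<and> boundary_condition E (\<Psi> n) (\<tau> n)) \<and>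
          (\<lambda>n. set_gdist E \<Lambda> (boundary E (\<Psi> n))) \<longlonglongrightarrow> \<infinity> \<longrightarrow>
          (\<lambda>n. tv_dist (marginal \<Lambda> (hc_measure E (\<Psi> n) (\<sigma> n)))
                       (marginal \<Lambda> (hc_measure E (\<Psi> n) (\<tau> n)))) \<longlonglongrightarrow> 0))"

text \<open>For independent sets, strong spatial mixing is weak spatial mixing on every subgraph.\<close>

definition SSM :: "'a set \<Rightarrow> ('a \<times> 'a) set \<Rightarrow> bool" where
  "SSM V E \<longleftrightarrow> (\<forall>V' E'. is_subgraph V' E' V E \<longrightarrow> WSM V' E')"

text \<open>
  The rooted tree in which \<open>c v\<close> is the number of children of \<open>v\<close>. Vertices are Ulam--Harris
  words read backwards: the children of \<open>v\<close> are \<open>i # v\<close> for \<open>i < c v\<close>. Values of \<open>c\<close> at words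
  that are not vertices of the tree are irrelevant.
\<close>

inductive_set tree_verts :: "(nat list \<Rightarrow> nat) \<Rightarrow> nat list set"
  for c :: "nat list \<Rightarrow> nat"
where
  root: "[] \<in> tree_verts c"
| child: "v \<in> tree_verts c \<Longrightarrow> i < c v \<Longrightarrow> i # v \<in> tree_verts c"

definition tree_edges :: "(nat list \<Rightarrow> nat) \<Rightarrow> (nat list \<times> nat list) set" where
  "tree_edges c = {(v, w). v \<in> tree_verts c \<and> w \<in> tree_verts c \<and>
                           (\<exists>i. w = i # v \<or> v = i # w)}"

definition poisson_tree :: "real \<Rightarrow> (nat list \<Rightarrow> nat) measure" where
  "poisson_tree d = (\<Pi>\<^sub>M v \<in> (UNIV :: nat list set). measure_pmf (poisson_pmf d))"

definition infinite_poisson_tree :: "real \<Rightarrow> (nat list \<Rightarrow> nat) measure" where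
  "infinite_poisson_tree d = uniform_measure (poisson_tree d) {c. infinite (tree_verts c)}"

definition WSM_not_SSM_as :: "real \<Rightarrow> bool" where
  "WSM_not_SSM_as d \<longleftrightarrow>
     (AE c in infinite_poisson_tree d.
        WSM (tree_verts c) (tree_edges c) \<and> \<not> SSM (tree_verts c) (tree_edges c))"

end

theory Submission
  imports Defs
begin

text \<open>
  Call a vertex winning if all its children are losing, and losing if some child is winning.
  In a maximum independent set a winning vertex is occupied unless its parent is, a vertex with
  at least two winning children is vacant, and a \<^emph>\<open>critical\<close> vertex, with exactly one winning child,
  forms with that child a pair of which exactly one is occupied. For \<open>d < e\<close> the map
  \<open>q \<mapsto> exp (- d q)\<close> has no 2-cycle besides its fixed point, so almost surely the status of every vertex
  is decided by finitely many generations. What remains random is then only the choice at critical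
  vertices, and these interact through parent-child steps between critical vertices and through
  the winning child of a critical vertex. If \<open>q\<close> is the fixed point and \<open>t = d q\<close>, these
  dependencies form a branching process of mean \<open>2 t\<^sup>2\<close>, which is subcritical exactly when
  \<open>t < 1 / sqrt 2\<close>, that is \<open>d < exp (1 / sqrt 2) / sqrt 2\<close>; finite dependency clusters give WSM.

  For \<open>d > e\<close> the map has a genuine 2-cycle, so with positive probability both children of a root of
  degree 2 stay undecided, and fully occupied or fully vacant boundaries at even depth force the root
  to opposite states. The same pair of boundaries refutes WSM on a subgraph consisting of a vertex
  with two leafless subtrees below it, and an infinite Poisson tree almost surely contains one.
\<close>

section \<open>Exchanges in maximum configurations on forests\<close>

definition forest_edges :: "nat list set \<Rightarrow> (nat list \<times> nat list) set" where
  "forest_edges V = {(v, w). v \<in> V \<and> w \<in> V \<and> (\<exists>i. w = i # v \<or> v = i # w)}"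

lemma tree_edges_eq: "tree_edges c = forest_edges (tree_verts c)"
  by (simp add: tree_edges_def forest_edges_def)

lemma forest_edgesI:
  "v \<in> V \<Longrightarrow> i # v \<in> V \<Longrightarrow> (v, i # v) \<in> forest_edges V"
  "v \<in> V \<Longrightarrow> i # v \<in> V \<Longrightarrow> (i # v, v) \<in> forest_edges V"
  by (auto simp: forest_edges_def)

lemma forest_edges_cases:
  assumes "(x, y) \<in> forest_edges V"
  obtains i where "x \<in> V" "y \<in> V" "y = i # x" | i where "x \<in> V" "y \<in> V" "x = i # y"
  using assms by (auto simp: forest_edges_def)

lemma is_subgraph_forest_edges:
  assumes "V' \<subseteq> V"
  shows "is_subgraph V' (forest_edges V') V (forest_edges V)"
  using assms
  by (auto simp: is_subgraph_def simple_graph_def forest_edges_def sym_def irrefl_def)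

lemma hc_max_configs_finite: "finite \<Psi> \<Longrightarrow> finite (hc_max_configs E \<Psi> \<sigma>)"
  by (rule finite_subset[of _ "Pow \<Psi>"]) (auto simp: hc_max_configs_def hc_configs_def)

lemma hc_max_configs_nonempty:
  assumes "finite \<Psi>" "boundary_condition E \<Psi> \<sigma>"
  shows "hc_max_configs E \<Psi> \<sigma> \<noteq> {}"
proof -
  let ?C = "hc_configs E \<Psi> \<sigma>"
  have "\<sigma> \<in> ?C" using assms by (auto simp: boundary_condition_def hc_configs_def boundary_def)
  moreover have "card J < Suc (card \<Psi>)" if "J \<in> ?C" for J
    using that assms card_mono[of \<Psi> J] by (auto simp: hc_configs_def)
  ultimately obtain I where "I \<in> ?C" "\<forall>J. J \<in> ?C \<longrightarrow> card J \<le> card I"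
    using ex_has_greatest_nat[of "\<lambda>J. J \<in> ?C" \<sigma> card "Suc (card \<Psi>)"] by (metis less_or_eq_imp_le)
  thus ?thesis by (auto simp: hc_max_configs_def)
qed

text \<open>
  Certificates that a vertex of the region \<open>\<Psi>\<close> is winning or losing given the boundary condition \<open>\<sigma>\<close>;
  on the boundary, occupied counts as winning and vacant as losing.
\<close>

inductive win lose for V \<Psi> \<sigma> :: "nat list set" where
  win_boundary: "v \<in> \<sigma> \<Longrightarrow> win V \<Psi> \<sigma> v"
| lose_boundary: "v \<in> boundary (forest_edges V) \<Psi> \<Longrightarrow> v \<notin> \<sigma> \<Longrightarrow> lose V \<Psi> \<sigma> v"
| win_inner: "v \<in> \<Psi> - boundary (forest_edges V) \<Psi> \<Longrightarrow>
    (\<And>i. i # v \<in> V \<Longrightarrow> lose V \<Psi> \<sigma> (i # v)) \<Longrightarrow> win V \<Psi> \<sigma> v"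
| lose_inner: "v \<in> \<Psi> - boundary (forest_edges V) \<Psi> \<Longrightarrow> i # v \<in> V \<Longrightarrow>
    win V \<Psi> \<sigma> (i # v) \<Longrightarrow> lose V \<Psi> \<sigma> v"

text \<open>Words grow at their head, so the descendants of \<open>v\<close> are the words with
  suffix \<open>v\<close>. The set is not cut down to \<open>V\<close> because it only bounds where
  an exchange may act.\<close>

definition below :: "nat list \<Rightarrow> nat list set" where
  "below v = range (\<lambda>w. w @ v)"

lemma below_self: "v \<in> below v" by (auto simp: below_def intro: image_eqI[of _ _ "[]"])
lemma below_Cons: "below (i # v) \<subseteq> below v"
  by (auto simp: below_def image_iff) 
lemma below_length: "x \<in> below v \<Longrightarrow> length v \<le> length x"
  by (auto simp: below_def)
lemma below_siblings: "x \<in> below v \<Longrightarrow> length x = length v \<Longrightarrow> x = v"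
  by (auto simp: below_def)

locale forest_region =
  fixes V \<Psi> \<sigma> :: "nat list set"
  assumes fin: "finite \<Psi>" and sub: "\<Psi> \<subseteq> V"
begin

abbreviation "E \<equiv> forest_edges V"
abbreviation "B \<equiv> boundary E \<Psi>"
abbreviation "C \<equiv> hc_configs E \<Psi> \<sigma>"
abbreviation "M \<equiv> hc_max_configs E \<Psi> \<sigma>"

lemma child_in: "v \<in> \<Psi> - B \<Longrightarrow> i # v \<in> V \<Longrightarrow> i # v \<in> \<Psi>"
  using sub forest_edgesI(1)[of v V i] by (auto simp: boundary_def)

lemma config_insert:
  assumes "I \<in> C" "v \<in> \<Psi> - B" "\<And>i. i # v \<in> V \<Longrightarrow> i # v \<notin> I" "\<And>i u. v = i # u \<Longrightarrow> u \<notin> I"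
  shows "insert v I \<in> C"
proof -
  have "(v, x) \<notin> E \<and> (x, v) \<notin> E" if "x \<in> insert v I" for x
    using that assms by (auto elim!: forest_edges_cases)
  thus ?thesis using assms by (auto simp: hc_configs_def indep_def)
qed

lemma config_remove:
  assumes "I \<in> C" "v \<in> \<Psi> - B"
  shows "I - {v} \<in> C"
  using assms by (auto simp: hc_configs_def indep_def)

lemma config_child:
  assumes "I \<in> C" "v \<in> I" "i # v \<in> V" shows "i # v \<notin> I"
  using assms sub forest_edgesI(1)[of v V i] by (auto simp: hc_configs_def indep_def)

lemma config_finite: "I \<in> C \<Longrightarrow> finite I"
  using fin by (auto simp: hc_configs_def intro: finite_subset)

text \<open>
  A winning vertex with vacant parent can be made occupied with a gain of one, and a losing vertex
  can be vacated at no loss, by changes below the vertex only.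
\<close>

lemma exchange:
  "win V \<Psi> \<sigma> v \<Longrightarrow> I \<in> C \<Longrightarrow> v \<notin> I \<Longrightarrow> (\<And>i u. v = i # u \<Longrightarrow> u \<notin> I) \<Longrightarrow>
    \<exists>I'\<in>C. v \<in> I' \<and> card I + 1 \<le> card I' \<and> (\<forall>x. x \<notin> below v \<longrightarrow> (x \<in> I' \<longleftrightarrow> x \<in> I))"
  "lose V \<Psi> \<sigma> v \<Longrightarrow> J \<in> C \<Longrightarrow> v \<in> J \<Longrightarrow>
    \<exists>I'\<in>C. v \<notin> I' \<and> card J \<le> card I' \<and> (\<forall>x. x \<notin> below v \<longrightarrow> (x \<in> I' \<longleftrightarrow> x \<in> J))"
proof (induction arbitrary: I and J rule: win_lose.inducts)
  case (win_boundary v)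
  thus ?case by (auto simp: hc_configs_def)
next
  case (lose_boundary v)
  thus ?case by (auto simp: hc_configs_def)
next
  case (win_inner v)
  define S where "S = {w \<in> V. \<exists>i. w = i # v}"
  have "S \<subseteq> \<Psi>" using child_in[OF win_inner(1)] by (auto simp: S_def)
  hence "finite S" using fin by (rule finite_subset)
  \<comment> \<open>The children are vacated one at a time, which needs the claim for every set
    \<open>T\<close> of children. Subtrees of distinct siblings are disjoint, so a child once
    vacated stays vacant.\<close>
  have "\<exists>I'\<in>C. T \<inter> I' = {} \<and> card I \<le> card I' \<and> (\<forall>x. x \<notin> (\<Union>w\<in>T. below w) \<longrightarrow> (x \<in> I' \<longleftrightarrow> x \<in> I))"
    if "finite T" "T \<subseteq> S" for T
    using that
  proof (induction T rule: finite_induct)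
    case empty
    thus ?case using win_inner.prems by auto
  next
    case (insert w T)
    then obtain I' where I': "I' \<in> C" "T \<inter> I' = {}" "card I \<le> card I'"
      "\<forall>x. x \<notin> (\<Union>w\<in>T. below w) \<longrightarrow> (x \<in> I' \<longleftrightarrow> x \<in> I)" by auto
    show ?case
    proof (cases "w \<in> I'")
      case False
      thus ?thesis using I' by (intro bexI[of _ I']) auto
    next
      case True
      obtain i where w: "w = i # v" "i # v \<in> V" using insert.prems by (auto simp: S_def)
  obtain I'' where I'': "I'' \<in> C" "w \<notin> I''" "card I' \<le> card I''"
        "\<forall>x. x \<notin> below w \<longrightarrow> (x \<in> I'' \<longleftrightarrow> x \<in> I')"

        using win_inner.IH(3)[OF w(2) I'(1)] True unfolding w(1) by blast
      have "u \<notin> below w" if "u \<in> T" for u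
        using that insert.prems insert.hyps w below_siblings[of u w] by (auto simp: S_def)
      hence "insert w T \<inter> I'' = {}" using I'' I' by auto
      moreover have "x \<in> I'' \<longleftrightarrow> x \<in> I" if "x \<notin> (\<Union>w\<in>insert w T. below w)" for x
        using that I'(4) I''(4) by blast
      ultimately show ?thesis using le_trans[OF I'(3) I''(3)] I''(1) by blast
    qed
  qed
  from this[OF \<open>finite S\<close> order_refl] obtain I' where I': "I' \<in> C" "S \<inter> I' = {}" "card I \<le> card I'"
      "\<forall>x. x \<notin> (\<Union>w\<in>S. below w) \<longrightarrow> (x \<in> I' \<longleftrightarrow> x \<in> I)" by blast
  \<comment> \<open>Only words longer than \<open>v\<close> have changed, so \<open>v\<close> and
    its parent are still vacant and \<open>v\<close> can be added.\<close>
  have short: "x \<notin> (\<Union>w\<in>S. below w)" if "length x \<le> length v" for x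
    using that by (auto simp: S_def dest!: below_length)
  have v: "v \<notin> I'" using I'(4) short[of v] win_inner.prems(2) by blast
  have p: "u \<notin> I'" if "v = i # u" for i u
    using I'(4) short[of u] win_inner.prems(3)[OF that] that by simp
  have "insert v I' \<in> C"
  proof (rule config_insert)
    show "i # v \<notin> I'" if "i # v \<in> V" for i using I'(2) that unfolding S_def by blast
  qed (fact I'(1) win_inner.IH(1) p)+
  moreover have "x \<notin> (\<Union>w\<in>S. below w)" if "x \<notin> below v" for x
    using that below_Cons by (auto simp: S_def)
  hence "x \<in> insert v I' \<longleftrightarrow> x \<in> I" if "x \<notin> below v" for x
    using that I'(4) below_self[of v] by blast
  moreover have "card I + 1 \<le> card (insert v I')"
    using I'(3) v config_finite[OF I'(1)] by simp
  ultimately show ?case by blast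
next
  case (lose_inner v i)
  have vB: "v \<in> \<Psi> - B" and iv: "i # v \<in> V" and JC: "J \<in> C" and vJ: "v \<in> J"
    using lose_inner.IH(1,2) lose_inner.prems by blast+
  \<comment> \<open>Removing \<open>v\<close> costs one and leaves the parent of the winning child
    vacant; occupying that child wins the one back.\<close>
  have I: "J - {v} \<in> C" by (rule config_remove[OF JC vB])
  have nI: "i # v \<notin> J - {v}" using config_child[OF JC vJ iv] by blast
  have par: "u \<notin> J - {v}" if "i # v = j # u" for j u using that by simp
  obtain I' where I': "I' \<in> C" "card (J - {v}) + 1 \<le> card I'"
    "\<forall>x. x \<notin> below (i # v) \<longrightarrow> (x \<in> I' \<longleftrightarrow> x \<in> J - {v})"
    using lose_inner.IH(4)[OF I nI] par by blast
  have "v \<notin> below (i # v)" using below_length[of v "i # v"] by auto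
  hence "v \<notin> I'" using I'(3) by blast
  moreover have "card (J - {v}) + 1 = card J"
    using vJ config_finite[OF JC] by (metis Suc_eq_plus1 card_Suc_Diff1)
  hence "card J \<le> card I'" using I'(2) by simp
  moreover have "x \<in> I' \<longleftrightarrow> x \<in> J" if "x \<notin> below v" for x
    using I'(3) that below_Cons[of i v] below_self[of v] by blast
  ultimately show ?case using I'(1) by blast
qed

lemma win_in_max:
  assumes "win V \<Psi> \<sigma> v" "I \<in> M" "\<And>i u. v = i # u \<Longrightarrow> u \<notin> I"
  shows "v \<in> I"
proof (rule ccontr)
  assume "v \<notin> I"
  then obtain I' where "I' \<in> C" "card I + 1 \<le> card I'"
    using exchange(1)[OF assms(1), of I] assms(2,3) by (auto simp: hc_max_configs_def)
  thus False using assms(2) by (auto simp: hc_max_configs_def)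
qed

text \<open>Vacating \<open>v\<close> costs one, while the two winning children then gain one each,
  in disjoint subtrees. An occupied \<open>v\<close> therefore contradicts maximality.\<close>

lemma two_wins_notin_max:
  assumes v: "v \<in> \<Psi> - B" and ij: "i \<noteq> j" "i # v \<in> V" "j # v \<in> V"
    and wi: "win V \<Psi> \<sigma> (i # v)" and wj: "win V \<Psi> \<sigma> (j # v)" and I: "I \<in> M"
  shows "v \<notin> I"
proof
  assume vI: "v \<in> I"
  have IC: "I \<in> C" using I by (simp add: hc_max_configs_def)
  have I0: "I - {v} \<in> C" by (rule config_remove[OF IC v])
  have "i # v \<notin> I" using config_child[OF IC vI ij(2)] .
  then obtain I1 where I1: "I1 \<in> C" "card (I - {v}) + 1 \<le> card I1"
    "\<forall>x. x \<notin> below (i # v) \<longrightarrow> (x \<in> I1 \<longleftrightarrow> x \<in> I - {v})"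
    using exchange(1)[OF wi I0] by auto
  \<comment> \<open>The first exchange stays below \<open>i # v\<close>, so \<open>v\<close> and
    \<open>j # v\<close> are still vacant when the second one starts.\<close>
  have "v \<notin> I1" using I1(3) below_length[of v "i # v"] by auto
  moreover have "j # v \<notin> I1"
    using I1(3) below_siblings[of "j # v" "i # v"] ij config_child[OF IC vI ij(3)] by auto
  ultimately obtain I2 where "I2 \<in> C" "card I1 + 1 \<le> card I2"
    using exchange(1)[OF wj I1(1)] by auto
  moreover have "card (I - {v}) + 1 = card I"
    using vI config_finite[OF IC] by (metis Suc_eq_plus1 card_Suc_Diff1)
  ultimately show False using I I1(2) by (fastforce simp: hc_max_configs_def)
qed

end

section \<open>Independence of the branches of a Poisson tree\<close>

definition shift :: "nat list \<Rightarrow> (nat list \<Rightarrow> nat) \<Rightarrow> (nat list \<Rightarrow> nat)" where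
  "shift v c = (\<lambda>w. c (w @ v))"

lemma shift_simps [simp]:
  "shift [] c = c" "shift v c [] = c v" "shift w (shift v c) = shift (w @ v) c"
  by (simp_all add: shift_def)

locale poisson_gw =
  fixes d :: real
  assumes d_pos: "d > 0"
begin

abbreviation "P \<equiv> poisson_tree d"

sublocale coord: product_prob_space "\<lambda>_. measure_pmf (poisson_pmf d)" "UNIV :: nat list set"
  by unfold_locales

sublocale P: prob_space P
  unfolding poisson_tree_def by (rule prob_space_PiM) (rule prob_space_measure_pmf)

lemma space_tree: "space P = UNIV"
  by (simp add: poisson_tree_def space_PiM)

lemma measurable_coord [measurable]: "(\<lambda>c. c v) \<in> P \<rightarrow>\<^sub>M count_space UNIV"
proof -
  have "(\<lambda>c. c v) \<in> P \<rightarrow>\<^sub>M measure_pmf (poisson_pmf d)"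
    unfolding poisson_tree_def by (rule measurable_component_singleton) simp
  thus ?thesis by (simp cong: measurable_cong_sets)
qed

lemma measurable_shift [measurable]: "shift v \<in> P \<rightarrow>\<^sub>M P"
proof -
  have "(\<lambda>c. \<lambda>w\<in>UNIV. c (w @ v)) \<in> P \<rightarrow>\<^sub>M P"
    unfolding poisson_tree_def
    by (intro measurable_restrict measurable_component_singleton) simp
  thus ?thesis by (simp add: shift_def[abs_def] restrict_UNIV)
qed

lemma distr_shift: "distr P P (shift v) = P"
proof -
  have "distr P P (\<lambda>c. \<lambda>w\<in>UNIV. c (w @ v)) = P"
    unfolding poisson_tree_def
    by (rule distr_PiM_reindex) (auto simp: inj_on_def prob_space_measure_pmf)
  thus ?thesis by (simp add: shift_def[abs_def] restrict_UNIV)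
qed

text \<open>Each shift preserves the law and there are countably many words, so one null set serves
  all of them, including words outside the tree.\<close>

lemma AE_shift:
  assumes "AE c in P. Q c" shows "AE c in P. \<forall>v. Q (shift v c)"
proof -
  have "AE c in P. Q (shift v c)" for v
    by (rule AE_distrD[OF measurable_shift]) (use assms in \<open>simp only: distr_shift\<close>)
  thus ?thesis by (simp add: AE_all_countable)
qed

lemma prob_shift:
  assumes [measurable]: "Measurable.pred P Q"
  shows "P.prob {c. Q (shift v c)} = P.prob {c. Q c}"
proof -
  have "{c. Q c} \<in> sets P" using assms by (simp add: Measurable.pred_def space_tree)
  hence "measure (distr P P (shift v)) {c. Q c} = P.prob (shift v -` {c. Q c} \<inter> space P)"
    by (intro measure_distr measurable_shift)
  thus ?thesis by (simp add: distr_shift space_tree vimage_def)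
qed


text \<open>The root degree and the branches at different children read disjoint sets of
  coordinates. The event may differ from child to child, so that one or two children can be singled
  out later.\<close>

lemma prob_branch:
  assumes B: "\<And>i. Measurable.pred P (B i)"
  shows "P.prob {c. c [] = k \<and> (\<forall>i<k. B i (shift [i] c))} =
           pmf (poisson_pmf d) k * (\<Prod>i<k. P.prob {c. B i c})"
proof -
  let ?N = "\<lambda>_::nat list. measure_pmf (poisson_pmf d)"
  have rv: "(\<lambda>c. c v) \<in> P \<rightarrow>\<^sub>M ?N v" for v
    unfolding poisson_tree_def by (rule measurable_component_singleton) simp
  have dc: "distr P (?N v) (\<lambda>c. c v) = ?N v" for v
    unfolding poisson_tree_def by (rule coord.PiM_component) simp
  have "P.indep_vars ?N (\<lambda>v c. c v) UNIV"
  proof (subst P.indep_vars_iff_distr_eq_PiM)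
    from dc show "distr P (Pi\<^sub>M UNIV ?N) (\<lambda>x. restrict (\<lambda>i. x i) UNIV) =
      Pi\<^sub>M UNIV (\<lambda>i. distr P (?N i) (\<lambda>c. c i))"
      by (simp add: poisson_tree_def restrict_UNIV distr_id2)
  qed (use rv in auto)
  \<comment> \<open>\<open>None\<close> is the block of the root coordinate, \<open>Some i\<close>
    the block of the words ending in \<open>i\<close>, that is, of the \<open>i\<close>-th
    branch.\<close>
  define K :: "nat option \<Rightarrow> nat list set" where
    "K j = (case j of None \<Rightarrow> {[]} | Some i \<Rightarrow> range (\<lambda>w. w @ [i]))" for j
  have disj: "disjoint_family_on K UNIV"
    by (auto simp: disjoint_family_on_def K_def split: option.splits)
  have ind: "P.indep_vars (\<lambda>j. Pi\<^sub>M (K j) ?N) (\<lambda>j c. restrict (\<lambda>v. c v) (K j)) UNIV"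
    by (rule P.indep_vars_restrict) (use \<open>P.indep_vars ?N _ _\<close> disj in auto)
  \<comment> \<open>The same events, expressed as sets of functions on a single block, as the
    independence of the restrictions requires.\<close>
  define S :: "nat option \<Rightarrow> (nat list \<Rightarrow> nat) set" where
    "S j = {x \<in> space (Pi\<^sub>M (K j) ?N). case j of None \<Rightarrow> x [] = k
       | Some i \<Rightarrow> B i (\<lambda>w\<in>UNIV. x (w @ [i]))}" for j
  have S: "S j \<in> sets (Pi\<^sub>M (K j) ?N)" for j
  proof (cases j)
    case None
    have "(\<lambda>x. x []) \<in> Pi\<^sub>M (K j) ?N \<rightarrow>\<^sub>M measure_pmf (poisson_pmf d)"
      by (rule measurable_component_singleton) (simp add: K_def None)
    hence "(\<lambda>x. x []) -` {k} \<inter> space (Pi\<^sub>M (K j) ?N) \<in> sets (Pi\<^sub>M (K j) ?N)"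
      by (rule measurable_sets) simp
    thus ?thesis by (simp add: S_def None vimage_def Int_def conj_commute)
  next
    case (Some i)
    have "(\<lambda>x. \<lambda>w\<in>UNIV. x (w @ [i])) \<in> Pi\<^sub>M (K j) ?N \<rightarrow>\<^sub>M P" unfolding poisson_tree_def
      by (intro measurable_restrict measurable_component_singleton) (auto simp: K_def Some)
    from measurable_compose[OF this B[of i]] show ?thesis
      by (simp add: S_def Some Measurable.pred_def)
  qed
  define J where "J = insert None (Some ` {..<k})"
  have vim: "(\<lambda>c. restrict (\<lambda>v. c v) (K j)) -` S j \<inter> space P =
      {c. case j of None \<Rightarrow> c [] = k | Some i \<Rightarrow> B i (shift [i] c)}" for j
    by (auto simp: S_def space_tree K_def space_PiM shift_def restrict_def PiE_def extensional_def
        split: option.splits)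
  have "P.prob (\<Inter>j\<in>J. (\<lambda>c. restrict (\<lambda>v. c v) (K j)) -` S j \<inter> space P) =
      (\<Prod>j\<in>J. P.prob ((\<lambda>c. restrict (\<lambda>v. c v) (K j)) -` S j \<inter> space P))"
    by (rule P.indep_varsD[OF ind]) (use S in \<open>auto simp: J_def\<close>)
  also have "(\<Inter>j\<in>J. (\<lambda>c. restrict (\<lambda>v. c v) (K j)) -` S j \<inter> space P) =
      {c. c [] = k \<and> (\<forall>i<k. B i (shift [i] c))}"
    unfolding vim by (auto simp: J_def)
  also have "(\<Prod>j\<in>J. P.prob ((\<lambda>c. restrict (\<lambda>v. c v) (K j)) -` S j \<inter> space P)) =
      P.prob {c. c [] = k} * (\<Prod>i<k. P.prob {c. B i (shift [i] c)})"
    unfolding vim J_def by (subst prod.insert) (auto simp: prod.reindex)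
  also have "P.prob {c. c [] = k} = pmf (poisson_pmf d) k"
    using measure_distr[OF rv, of "{k}" "[]"]
    by (simp add: dc space_tree vimage_def measure_pmf_single)
  finally show ?thesis by (simp add: prob_shift B)
qed

end

section \<open>The Poisson generating function and events about the children of the root\<close>

context poisson_gw begin

lemma measurable_coord_pred [measurable]: "Measurable.pred P (\<lambda>c. Q (c v))"
  by (rule measurable_compose[OF measurable_coord]) simp

lemma pred_sets: "Measurable.pred P Q \<Longrightarrow> {c. Q c} \<in> sets P"
  by (simp add: Measurable.pred_def space_tree)

lemma measurable_pred_shift: "Measurable.pred P Q \<Longrightarrow> Measurable.pred P (\<lambda>c. Q (shift v c))"
  by (rule measurable_compose[OF measurable_shift])

lemma prob_sums_root:
  assumes Q [measurable]: "Measurable.pred P Q"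
  shows "(\<lambda>k. P.prob {c. c [] = k \<and> Q c}) sums P.prob {c. Q c}"
proof -
  have "(\<lambda>k. P.prob {c. c [] = k \<and> Q c}) sums P.prob (\<Union>k. {c. c [] = k \<and> Q c})"
    by (rule P.finite_measure_UNION)
       (auto simp: disjoint_family_on_def intro!: pred_sets)
  moreover have "(\<Union>k. {c. c [] = k \<and> Q c}) = {c. Q c}" by auto
  ultimately show ?thesis by simp
qed

text \<open>The generating function of the offspring law; \<open>poisson_sums1\<close> and
  \<open>poisson_sums2\<close> are its first two derivatives, obtained by shifting the index instead
  of differentiating.\<close>

lemma poisson_sums0: "(\<lambda>k. pmf (poisson_pmf d) k * x ^ k) sums exp (- d * (1 - x))"
proof -
  have "(\<lambda>k. exp (-d) * ((d * x) ^ k /\<^sub>R fact k)) sums (exp (-d) * exp (d * x))"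
    by (intro sums_mult exp_converges)
  also have "exp (-d) * exp (d * x) = exp (- d * (1 - x))"
    by (simp add: exp_add[symmetric] algebra_simps)
  finally show ?thesis
    using d_pos by (simp add: power_mult_distrib field_simps)
qed

lemma poisson_pmf_Suc:
  "pmf (poisson_pmf d) (Suc k) * real (Suc k) = d * pmf (poisson_pmf d) k"
  using d_pos by (simp add: divide_simps) 

lemma poisson_sums1:
  "(\<lambda>k. pmf (poisson_pmf d) k * (real k * x ^ (k - 1))) sums (d * exp (- d * (1 - x)))"
proof -
  let ?f = "\<lambda>k. pmf (poisson_pmf d) k * (real k * x ^ (k - 1))"
  have "?f (Suc k) = d * (pmf (poisson_pmf d) k * x ^ k)" for k
    using poisson_pmf_Suc[of k] by (metis diff_Suc_1 mult.assoc)
  hence "(\<lambda>k. ?f (Suc k)) sums (d * exp (- d * (1 - x)))"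
    using sums_mult[OF poisson_sums0[of x], of d] by presburger
  from sums_Suc[OF this] show ?thesis by simp
qed

lemma poisson_sums2:
  "(\<lambda>k. pmf (poisson_pmf d) k * (real (k * (k - 1)) * x ^ (k - 2)))
     sums (d ^ 2 * exp (- d * (1 - x)))"
proof -
  let ?f = "\<lambda>k. pmf (poisson_pmf d) k * (real (k * (k - 1)) * x ^ (k - 2))"
  have "?f (Suc k) = d * (pmf (poisson_pmf d) k * (real k * x ^ (k - 1)))" for k
  proof -
    have "?f (Suc k) = (pmf (poisson_pmf d) (Suc k) * real (Suc k)) * (real k * x ^ (k - 1))"
      by (simp only: diff_Suc_1 of_nat_mult diff_Suc_Suc numeral_2_eq_2 mult.assoc One_nat_def diff_zero)
    thus ?thesis by (simp only: poisson_pmf_Suc mult.assoc)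
  qed
  hence "(\<lambda>k. ?f (Suc k)) sums (d * (d * exp (- d * (1 - x))))"
    using sums_mult[OF poisson_sums1[of x], of d] by presburger
  from sums_Suc[OF this] show ?thesis by (simp add: power2_eq_square mult.assoc)
qed

text \<open>Summing \<open>prob_branch\<close> over the root degree gives the generating function at
  the probability of \<open>B\<close>.\<close>

lemma prob_all_children:
  assumes B [measurable]: "Measurable.pred P B"
  shows "P.prob {c. \<forall>i<c []. B (shift [i] c)} = exp (- d * (1 - P.prob {c. B c}))"
proof -
  have [measurable]: "Measurable.pred P (\<lambda>c. B (shift v c))" for v
    by (rule measurable_pred_shift) fact
  have "(\<lambda>k. P.prob {c. c [] = k \<and> (\<forall>i<c []. B (shift [i] c))})
          sums P.prob {c. \<forall>i<c []. B (shift [i] c)}"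
    by (rule prob_sums_root) measurable
  moreover have "P.prob {c. c [] = k \<and> (\<forall>i<c []. B (shift [i] c))} =
      pmf (poisson_pmf d) k * P.prob {c. B c} ^ k" for k
    using prob_branch[of "\<lambda>_. B" k] B by (simp cong: conj_cong)
  ultimately show ?thesis using sums_unique2[OF _ poisson_sums0] by simp
qed

text \<open>A union bound over the distinguished child \<open>i\<close> gives \<open>k\<close> equal
  terms for root degree \<open>k\<close>, hence the first derivative of the generating
  function.\<close>

lemma prob_one_child_le:
  assumes A [measurable]: "Measurable.pred P A" and B [measurable]: "Measurable.pred P B"
  shows "P.prob {c. \<exists>i<c []. A (shift [i] c) \<and> (\<forall>j<c []. j \<noteq> i \<longrightarrow> B (shift [j] c))}
           \<le> d * P.prob {c. A c} * exp (- d * (1 - P.prob {c. B c}))"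
proof -
  let ?Q = "\<lambda>c. \<exists>i<c []. A (shift [i] c) \<and> (\<forall>j<c []. j \<noteq> i \<longrightarrow> B (shift [j] c))"
  let ?R = "\<lambda>k i c. c [] = k \<and> (\<forall>j<k. (if j = i then A else B) (shift [j] c))"
  have m [measurable]: "Measurable.pred P (\<lambda>c. A (shift v c))" "Measurable.pred P (\<lambda>c. B (shift v c))" for v
    by (rule measurable_pred_shift; fact)+
  have mR: "Measurable.pred P (?R k i)" for k i
    by (intro pred_intros_logic pred_intros_countable measurable_coord_pred) (auto intro: m)
  have s: "(\<lambda>k. P.prob {c. c [] = k \<and> ?Q c}) sums P.prob {c. ?Q c}"
    by (rule prob_sums_root) measurable
  have le: "P.prob {c. c [] = k \<and> ?Q c} \<le>
     P.prob {c. A c} * (pmf (poisson_pmf d) k * (real k * P.prob {c. B c} ^ (k - 1)))" for k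
  proof -
    have "{c. c [] = k \<and> ?Q c} = (\<Union>i\<in>{..<k}. {c. ?R k i c})" by auto
    also have "P.prob \<dots> \<le> (\<Sum>i\<in>{..<k}. P.prob {c. ?R k i c})"
      by (rule P.finite_measure_subadditive_finite) (auto intro!: pred_sets mR)
    also have "\<dots> = (\<Sum>i\<in>{..<k}. pmf (poisson_pmf d) k * (P.prob {c. A c} * P.prob {c. B c} ^ (k - 1)))"
    proof (rule sum.cong[OF refl])
      fix i assume i: "i \<in> {..<k}"
      have "P.prob {c. ?R k i c} = pmf (poisson_pmf d) k * (\<Prod>j<k. P.prob {c. (if j = i then A else B) c})"
        by (rule prob_branch) (auto intro: A B)
      also have "(\<Prod>j<k. P.prob {c. (if j = i then A else B) c}) =
          P.prob {c. A c} * (\<Prod>j\<in>{..<k}-{i}. P.prob {c. B c})"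
        using i by (subst prod.remove[of _ i]) auto
      finally show "P.prob {c. ?R k i c} = 
         pmf (poisson_pmf d) k * (P.prob {c. A c} * P.prob {c. B c} ^ (k - 1))"
        using i by simp
    qed
    finally show ?thesis by (simp add: mult_ac)
  qed
  have "P.prob {c. ?Q c} \<le> P.prob {c. A c} * (d * exp (- d * (1 - P.prob {c. B c})))"
    by (rule sums_le[OF le s sums_mult[OF poisson_sums1]])
  thus ?thesis by (simp add: mult_ac)
qed

text \<open>As for one child, with a union bound over ordered pairs of distinct children; this
  produces the second derivative.\<close>

lemma prob_two_children_le:
  assumes A [measurable]: "Measurable.pred P A" and A' [measurable]: "Measurable.pred P A'"
    and B [measurable]: "Measurable.pred P B"
  shows "P.prob {c. \<exists>i<c []. \<exists>j<c []. i \<noteq> j \<and> A (shift [i] c) \<and> A' (shift [j] c) \<and>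
             (\<forall>l<c []. l \<noteq> i \<and> l \<noteq> j \<longrightarrow> B (shift [l] c))}
           \<le> d ^ 2 * P.prob {c. A c} * P.prob {c. A' c} * exp (- d * (1 - P.prob {c. B c}))"
proof -
  let ?Q = "\<lambda>c. \<exists>i<c []. \<exists>j<c []. i \<noteq> j \<and> A (shift [i] c) \<and> A' (shift [j] c) \<and>
             (\<forall>l<c []. l \<noteq> i \<and> l \<noteq> j \<longrightarrow> B (shift [l] c))"
  let ?S = "\<lambda>p l. if l = fst p then A else if l = snd p then A' else B"
  let ?R = "\<lambda>k p c. c [] = k \<and> (\<forall>l<k. ?S p l (shift [l] c))"
  have m [measurable]: "Measurable.pred P (\<lambda>c. A (shift v c))" "Measurable.pred P (\<lambda>c. A' (shift v c))"
    "Measurable.pred P (\<lambda>c. B (shift v c))" for v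
    by (rule measurable_pred_shift; fact)+
  have mR: "Measurable.pred P (?R k p)" for k p
    by (intro pred_intros_logic pred_intros_countable measurable_coord_pred) (auto intro: m)
  have s: "(\<lambda>k. P.prob {c. c [] = k \<and> ?Q c}) sums P.prob {c. ?Q c}"
    by (rule prob_sums_root) measurable
  have le: "P.prob {c. c [] = k \<and> ?Q c} \<le> P.prob {c. A c} * P.prob {c. A' c} *
     (pmf (poisson_pmf d) k * (real (k * (k - 1)) * P.prob {c. B c} ^ (k - 2)))" for k
  proof -
    define I where "I = (SIGMA i:{..<k}. {..<k} - {i})"
    have fI: "finite I" by (simp add: I_def)
    have cI: "card I = k * (k - 1)" by (simp add: I_def card_SigmaI)
    have "{c. c [] = k \<and> ?Q c} \<subseteq> (\<Union>p\<in>I. {c. ?R k p c})"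
    proof
      fix c assume "c \<in> {c. c [] = k \<and> ?Q c}"
      then obtain i j where "c [] = k" "i < k" "j < k" "i \<noteq> j" "A (shift [i] c)" "A' (shift [j] c)"
        "\<forall>l<k. l \<noteq> i \<and> l \<noteq> j \<longrightarrow> B (shift [l] c)" by blast
      thus "c \<in> (\<Union>p\<in>I. {c. ?R k p c})"
        by (intro UN_I[of "(i, j)"]) (auto simp: I_def)
    qed
    hence "P.prob {c. c [] = k \<and> ?Q c} \<le> P.prob (\<Union>p\<in>I. {c. ?R k p c})"
      using fI by (intro P.finite_measure_mono sets.finite_UN) (auto intro!: pred_sets mR)
    also have "\<dots> \<le> (\<Sum>p\<in>I. P.prob {c. ?R k p c})"
      using fI by (intro P.finite_measure_subadditive_finite) (auto intro!: pred_sets mR)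
    also have "\<dots> = (\<Sum>p\<in>I. pmf (poisson_pmf d) k *
        (P.prob {c. A c} * P.prob {c. A' c} * P.prob {c. B c} ^ (k - 2)))"
    proof (rule sum.cong[OF refl])
      fix p assume "p \<in> I"
      then obtain i j where p: "p = (i, j)" "i < k" "j < k" "i \<noteq> j" by (auto simp: I_def)
      have "P.prob {c. ?R k p c} = pmf (poisson_pmf d) k * (\<Prod>l<k. P.prob {c. ?S p l c})"
        by (rule prob_branch) (auto intro: A A' B)
      also have "(\<Prod>l<k. P.prob {c. ?S p l c}) =
          P.prob {c. A c} * (P.prob {c. A' c} * (\<Prod>l\<in>{..<k}-{i}-{j}. P.prob {c. B c}))"
        using p by (subst prod.remove[of _ i], simp, simp, subst prod.remove[of _ j]) auto
      finally show "P.prob {c. ?R k p c} = pmf (poisson_pmf d) k *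
          (P.prob {c. A c} * P.prob {c. A' c} * P.prob {c. B c} ^ (k - 2))"
        using p by (simp add: card_Diff_subset numeral_2_eq_2)
    qed
    finally show ?thesis by (simp add: cI mult_ac)
  qed
  have "P.prob {c. ?Q c} \<le> P.prob {c. A c} * P.prob {c. A' c} * (d ^ 2 * exp (- d * (1 - P.prob {c. B c})))"
    by (rule sums_le[OF le s sums_mult[OF poisson_sums2]])
  thus ?thesis by (simp add: mult_ac)
qed

end

section \<open>Winning and losing vertices\<close>

text \<open>
  Status of the root when all vertices at depth \<open>k\<close> are declared winning. It decides winning vertices
  for odd \<open>k\<close> and losing vertices for even \<open>k\<close>: the former hold increasingly, the latter decreasingly in \<open>k\<close>.
\<close>

primrec peel :: "nat \<Rightarrow> (nat list \<Rightarrow> nat) \<Rightarrow> bool" where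
  "peel 0 c = True"
| "peel (Suc k) c = (\<forall>i<c []. \<not> peel k (shift [i] c))"

definition winning :: "(nat list \<Rightarrow> nat) \<Rightarrow> bool" where
  "winning c \<longleftrightarrow> (\<exists>k. peel (2 * k + 1) c)"

definition losing :: "(nat list \<Rightarrow> nat) \<Rightarrow> bool" where
  "losing c \<longleftrightarrow> (\<exists>k. \<not> peel (2 * k) c)"

text \<open>The other children are only required not to be winning. Where every vertex is winning or
  losing, this means that they are losing.\<close>

definition critical :: "(nat list \<Rightarrow> nat) \<Rightarrow> bool" where
  "critical c \<longleftrightarrow> (\<exists>i<c []. winning (shift [i] c) \<and> (\<forall>j<c []. j \<noteq> i \<longrightarrow> \<not> winning (shift [j] c)))"

text \<open>
  The steps along which the choices at critical vertices constrain each other.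
\<close>

definition link :: "(nat list \<Rightarrow> nat) \<Rightarrow> nat \<Rightarrow> bool" where
  "link c i \<longleftrightarrow> critical c \<and> (critical (shift [i] c) \<or> winning (shift [i] c)) \<or>
     winning c \<and> critical (shift [i] c)"

text \<open>Descending paths of \<open>n\<close> links. A bound on their length makes the dependency
  cluster below a vertex finite, because degrees are finite.\<close>

primrec chain :: "nat \<Rightarrow> (nat list \<Rightarrow> nat) \<Rightarrow> bool" where
  "chain 0 c = True"
| "chain (Suc n) c = (\<exists>i<c []. link c i \<and> chain n (shift [i] c))"

text \<open>At depth 0 \<open>peel\<close> takes its largest value, and each generation negates the
  status of the children; so the direction of the comparison flips with the parity of
  \<open>k\<close>.\<close>

lemma peel_alternate: "k \<le> m \<Longrightarrow> (even k \<longrightarrow> peel m c \<longrightarrow> peel k c) \<and> (odd k \<longrightarrow> peel k c \<longrightarrow> peel m c)"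
proof (induction k arbitrary: m c)
  case (Suc k)
  then obtain m' where "m = Suc m'" "k \<le> m'" by (cases m) auto
  thus ?case using Suc.IH[of m'] by simp blast
qed simp

lemma peel_odd_imp_even: "odd k \<Longrightarrow> even m \<Longrightarrow> peel k c \<Longrightarrow> peel m c"
  using peel_alternate[of k m c] peel_alternate[of m k c] by (cases "k \<le> m") auto

lemma not_winning_losing: "winning c \<Longrightarrow> losing c \<Longrightarrow> False"
  using peel_odd_imp_even[of "2 * _ + 1" "2 * _"] unfolding winning_def losing_def by auto

lemma winning_child_losing:
  assumes "winning c" "i < c []" shows "losing (shift [i] c)"
  using assms by (auto simp: winning_def losing_def)

lemma winningI:
  assumes "\<And>i. i < c [] \<Longrightarrow> losing (shift [i] c)" shows "winning c"
proof -
  from assms obtain k where k: "\<And>i. i < c [] \<Longrightarrow> \<not> peel (2 * k i) (shift [i] c)"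
    unfolding losing_def by metis
  \<comment> \<open>A common depth for finitely many children: the sum bounds each
    \<open>k i\<close>, and a losing certificate survives at every larger even depth.\<close>
  define K where "K = (\<Sum>i<c []. k i)"
  have "\<not> peel (2 * K) (shift [i] c)" if "i < c []" for i
  proof -
    have "k i \<le> K" unfolding K_def using that by (intro member_le_sum) auto
    thus ?thesis using k[OF that] peel_alternate[of "2 * k i" "2 * K" "shift [i] c"] by simp
  qed
  hence "peel (2 * K + 1) c" by simp
  thus ?thesis unfolding winning_def by blast
qed

lemma chain_Suc_imp: "chain (Suc n) c \<Longrightarrow> chain n c"
proof (induction n arbitrary: c)
  case (Suc n)
  from Suc.prems obtain i where "i < c []" "link c i" "chain (Suc n) (shift [i] c)"
    unfolding chain.simps(2)[of "Suc n"] by blast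
  thus ?case using Suc.IH unfolding chain.simps(2)[of n c] by blast
qed simp

lemma winning_not_critical: "winning c \<Longrightarrow> critical c \<Longrightarrow> False"
  using winning_child_losing not_winning_losing unfolding critical_def by blast

section \<open>Absence of 2-cycles of \<open>q \<mapsto> exp (- d * q)\<close> for
  \<open>d < exp 1\<close>\<close>

lemma exp_gt_add_one: "(x::real) \<noteq> 0 \<Longrightarrow> 1 + x < exp x"
proof -
  assume x: "x \<noteq> 0"
  show ?thesis
  proof (cases "1 + x \<le> 0")
    case True thus ?thesis using exp_gt_zero[of x] by linarith
  next
    case False
    \<comment> \<open>Squaring the weak inequality at \<open>x / 2\<close> leaves the surplus
      \<open>(x / 2)\<^sup>2\<close>, which makes it strict.\<close>
    hence "0 < 1 + x / 2" by linarith
    hence "(1 + x / 2)\<^sup>2 \<le> (exp (x / 2))\<^sup>2" using exp_ge_add_one_self[of "x/2"] by (intro power_mono) auto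
    moreover have "(exp (x / 2))\<^sup>2 = exp x" by (simp add: power2_eq_square flip: exp_add)
    moreover have "(1 + x / 2)\<^sup>2 = 1 + x + (x / 2)\<^sup>2" by (simp add: power2_eq_square algebra_simps)
    moreover have "(x / 2)\<^sup>2 > 0" using x by simp
    ultimately show ?thesis by linarith
  qed
qed

lemma mult_exp_minus_strict_mono:
  fixes y z :: real assumes "0 \<le> y" "y < z" "z \<le> 1"
  shows "y * exp (- y) < z * exp (- z)"
proof -
  have "z * (z - y) \<le> 1 * (z - y)" using assms by (intro mult_right_mono) auto
  hence "y \<le> z * (1 + (y - z))" by (simp add: algebra_simps)
  also have "\<dots> < z * exp (y - z)" using assms exp_gt_add_one[of "y - z"] by (intro mult_strict_left_mono) auto
  finally have "y * exp (- y) < (z * exp (y - z)) * exp (- y)" by (intro mult_strict_right_mono) auto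
  also have "\<dots> = z * exp (- z)" by (simp add: mult.assoc flip: exp_add)
  finally show ?thesis .
qed

text \<open>The function \<open>exp (1 - x) + ln x\<close> equals 1 at \<open>x = 1\<close> and has
  derivative \<open>1 / x - exp (1 - x)\<close>, which is positive for \<open>x > 1\<close>.\<close>

lemma one_minus_ln_less:
  fixes p :: real assumes "p > 1" shows "1 - ln p < exp (1 - p)"
proof -
  have "(\<lambda>x. exp (1 - x) + ln x) 1 < (\<lambda>x. exp (1 - x) + ln x) p"
  proof (rule DERIV_pos_imp_increasing_open[OF assms])
    fix x :: real assume x: "1 < x" "x < p"
    have "((\<lambda>x. exp (1 - x) + ln x) has_real_derivative - exp (1 - x) + 1 / x) (at x)"
      using x by (auto intro!: derivative_eq_intros)
    moreover have "x < exp (x - 1)" using exp_gt_add_one[of "x - 1"] x by simp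
    hence "x * exp (1 - x) < exp (x - 1) * exp (1 - x)" by simp
    hence "exp (1 - x) < 1 / x" using x by (simp add: field_simps flip: exp_add)
    ultimately show "\<exists>y. DERIV (\<lambda>x. exp (1 - x) + ln x) x :> y \<and> 0 < y"
      by (intro exI[of _ "- exp (1 - x) + 1 / x"]) auto
  qed (auto intro!: continuous_intros)
  thus ?thesis by simp
qed

text \<open>A proper cycle gives \<open>q < p\<close> with
  \<open>q * exp (- q) = p * exp (- p)\<close>, so \<open>p\<close> lies beyond the maximum of
  \<open>y * exp (- y)\<close> at 1. Since \<open>d = p * exp q\<close>, the bound
  \<open>d < exp 1\<close> pushes \<open>q\<close> too far down for this equality.\<close>

lemma no_two_cycle:
  fixes a b d :: real
  assumes d: "0 < d" "d < exp 1" and a: "a = exp (- d * b)" and b: "b = exp (- d * a)" and "a \<le> b"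
  shows "a = b"
proof (rule ccontr)
  assume "a \<noteq> b"
  define p q where "p = d * b" and "q = d * a"
  have qp: "q < p" using \<open>a \<le> b\<close> \<open>a \<noteq> b\<close> d by (simp add: p_def q_def)
  have q: "q = d * exp (- p)" and p: "p = d * exp (- q)" using a b by (simp_all add: p_def q_def)
  have q0: "q > 0" using d q by simp
  have d': "d = p * exp q" using p by (simp add: exp_minus field_simps)
  have "q * exp (- q) = p * exp (- p)" using p q by (metis mult.commute mult.left_commute)
  hence p1: "p > 1" using mult_exp_minus_strict_mono[of q p] qp q0 by force
  show False
  \<comment> \<open>The threshold \<open>1 - ln p\<close> is the value of \<open>q\<close> at which
    \<open>p * exp q\<close> equals \<open>exp 1\<close>.\<close>
  proof (cases "1 - ln p \<le> q")
    case True
    have "exp 1 = p * exp (1 - ln p)" using p1 by (simp add: exp_diff)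
    also have "\<dots> \<le> p * exp q" using True p1 by simp
    finally show False using d d' by simp
  next
    case False
    hence "q * exp (- q) < (1 - ln p) * exp (- (1 - ln p))"
      using p1 q0 by (intro mult_exp_minus_strict_mono) auto
    also have "\<dots> < exp (1 - p) * exp (- (1 - ln p))"
      using one_minus_ln_less[OF p1] by simp
    also have "\<dots> = exp (ln p) * exp (- p)" by (simp flip: exp_add)
    also have "\<dots> = p * exp (- p)" using p1 by simp
    finally show False using \<open>q * exp (- q) = p * exp (- p)\<close> by simp
  qed
qed

section \<open>Probabilities of winning, losing and undetermined roots\<close>

context poisson_gw begin

lemma measurable_peel [measurable]: "Measurable.pred P (peel k)"
proof (induction k)
  case (Suc k)
  have [measurable]: "Measurable.pred P (\<lambda>c. peel k (shift v c))" for v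
    by (rule measurable_pred_shift[OF Suc])
  show ?case unfolding peel.simps by measurable
qed simp

lemma measurable_winning [measurable]: "Measurable.pred P winning"
  unfolding winning_def[abs_def] by measurable

lemma measurable_losing [measurable]: "Measurable.pred P losing"
  unfolding losing_def[abs_def] by measurable

lemma measurable_critical [measurable]: "Measurable.pred P critical"
proof -
  have [measurable]: "Measurable.pred P (\<lambda>c. winning (shift v c))" for v
    by (rule measurable_pred_shift) measurable
  show ?thesis unfolding critical_def[abs_def] by measurable
qed

lemma measurable_chain [measurable]: "Measurable.pred P (chain n)"
proof (induction n)
  case (Suc n)
  have [measurable]: "Measurable.pred P (\<lambda>c. chain n (shift v c))" for v
    by (rule measurable_pred_shift[OF Suc])
  have [measurable]: "Measurable.pred P (\<lambda>c. winning (shift v c))"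
    "Measurable.pred P (\<lambda>c. critical (shift v c))" for v
    by (rule measurable_pred_shift, measurable)+
  show ?case unfolding chain.simps link_def by measurable
qed simp

lemma prob_not:
  assumes "Measurable.pred P Q" shows "P.prob {c. \<not> Q c} = 1 - P.prob {c. Q c}"
proof -
  have "{c. \<not> Q c} = space P - {c. Q c}" by (auto simp: space_tree)
  thus ?thesis using P.prob_compl[OF pred_sets[OF assms]] by simp
qed

definition peel_prob :: "nat \<Rightarrow> real" where "peel_prob k = P.prob {c. peel k c}"

lemma peel_prob_0: "peel_prob 0 = 1" using P.prob_space by (simp add: peel_prob_def space_tree)

lemma peel_prob_Suc: "peel_prob (Suc k) = exp (- d * peel_prob k)"
proof -
  have "peel_prob (Suc k) = exp (- d * (1 - P.prob {c. \<not> peel k c}))"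
    unfolding peel_prob_def peel.simps by (rule prob_all_children) measurable
  thus ?thesis by (simp add: prob_not peel_prob_def)
qed

text \<open>The limits of \<open>peel_prob\<close> along odd and even indices. The map
  \<open>x \<mapsto> exp (- d * x)\<close> swaps them, so they form a 2-cycle or coincide in a fixed
  point; their gap is the probability of an undetermined root.\<close>

definition win_prob :: real where "win_prob = P.prob {c. winning c}"
definition unlost_prob :: real where "unlost_prob = 1 - P.prob {c. losing c}"

lemma peel_prob_odd_tendsto: "(\<lambda>k. peel_prob (2 * k + 1)) \<longlonglongrightarrow> win_prob"
proof -
  have "(\<lambda>k. P.prob {c. peel (2 * k + 1) c}) \<longlonglongrightarrow> P.prob (\<Union>k. {c. peel (2 * k + 1) c})"
  proof (rule P.finite_Lim_measure_incseq)
    show "incseq (\<lambda>k. {c. peel (2 * k + 1) c})"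
      unfolding incseq_def using peel_alternate[of "2 * _ + 1" "2 * _ + 1"] by auto
  qed (use pred_sets[OF measurable_peel] in blast)
  moreover have "(\<Union>k. {c. peel (2 * k + 1) c}) = {c. winning c}" by (auto simp: winning_def)
  ultimately show ?thesis by (simp add: peel_prob_def win_prob_def)
qed

lemma peel_prob_even_tendsto: "(\<lambda>k. peel_prob (2 * k)) \<longlonglongrightarrow> unlost_prob"
proof -
  have "(\<lambda>k. P.prob {c. peel (2 * k) c}) \<longlonglongrightarrow> P.prob (\<Inter>k. {c. peel (2 * k) c})"
  proof (rule P.finite_Lim_measure_decseq)
    show "decseq (\<lambda>k. {c. peel (2 * k) c})"
      unfolding decseq_def using peel_alternate[of "2 * _" "2 * _"] by auto
  qed (use pred_sets[OF measurable_peel] in blast)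
  moreover have "(\<Inter>k. {c. peel (2 * k) c}) = {c. \<not> losing c}" by (auto simp: losing_def)
  ultimately show ?thesis by (simp add: peel_prob_def unlost_prob_def prob_not)
qed

lemma win_prob_eq: "win_prob = exp (- d * unlost_prob)"
proof -
  have "(\<lambda>k. peel_prob (2 * k + 1)) \<longlonglongrightarrow> exp (- d * unlost_prob)"
    using peel_prob_Suc by (auto intro!: tendsto_intros peel_prob_even_tendsto)
  thus ?thesis using peel_prob_odd_tendsto LIMSEQ_unique by blast
qed

lemma unlost_prob_eq: "unlost_prob = exp (- d * win_prob)"
proof -
  have "(\<lambda>k. peel_prob (2 * Suc k)) \<longlonglongrightarrow> exp (- d * win_prob)"
    using peel_prob_Suc peel_prob_odd_tendsto by (auto intro!: tendsto_intros)
  moreover have "(\<lambda>k. peel_prob (2 * Suc k)) \<longlonglongrightarrow> unlost_prob"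
    using LIMSEQ_Suc[OF peel_prob_even_tendsto] .
  ultimately show ?thesis using LIMSEQ_unique by blast
qed

lemma prob_undetermined: "P.prob {c. \<not> winning c \<and> \<not> losing c} = unlost_prob - win_prob"
proof -
  have "{c. \<not> losing c} = {c. \<not> winning c \<and> \<not> losing c} \<union> {c. winning c}"
    using not_winning_losing by auto
  hence "P.prob {c. \<not> losing c} = P.prob ({c. \<not> winning c \<and> \<not> losing c} \<union> {c. winning c})" by simp
  also have "\<dots> = P.prob {c. \<not> winning c \<and> \<not> losing c} + P.prob {c. winning c}"
    by (rule P.finite_measure_Union) (auto intro!: pred_sets)
  finally show ?thesis by (simp add: prob_not win_prob_def unlost_prob_def)
qed

lemma win_prob_le_unlost_prob: "win_prob \<le> unlost_prob"
  using prob_undetermined by (metis diff_ge_0_iff_ge measure_nonneg)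

lemma win_prob_eq_unlost_prob: "d < exp 1 \<Longrightarrow> win_prob = unlost_prob"
  using no_two_cycle[OF d_pos _ win_prob_eq unlost_prob_eq win_prob_le_unlost_prob] by blast

lemma AE_determined:
  assumes "d < exp 1" shows "AE c in P. winning c \<or> losing c"
proof -
  have "P.prob {c. \<not> winning c \<and> \<not> losing c} = 0"
    using prob_undetermined win_prob_eq_unlost_prob[OF assms] by simp
  hence "{c. \<not> winning c \<and> \<not> losing c} \<in> null_sets P"
    by (intro null_setsI pred_sets) (auto simp: P.emeasure_eq_measure)
  from AE_not_in[OF this] show ?thesis by eventually_elim auto
qed

end

section \<open>Dependency chains and branching\<close>

lemma tree_Cons [simp]: "i # v \<in> tree_verts c \<longleftrightarrow> v \<in> tree_verts c \<and> i < c v"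
  by (subst tree_verts.simps) auto

lemma shift_apply: "shift v c w = c (w @ v)"
  by (simp add: shift_def)

lemma tree_Nil [simp]: "[] \<in> tree_verts c"
  by (rule tree_verts.root)

text \<open>\<open>tree_verts\<close> extends words at the head, away from the root; splitting a
  tree into its root branches has to look at the last letter.\<close>

lemma tree_snoc: "v @ [i] \<in> tree_verts c \<longleftrightarrow> i < c [] \<and> v \<in> tree_verts (shift [i] c)"
  by (induction v) (auto simp: shift_def)

lemma finite_tree_iff:
  "finite (tree_verts c) \<longleftrightarrow> (\<forall>i<c []. finite (tree_verts (shift [i] c)))"
proof -
  have eq: "tree_verts c = insert [] (\<Union>i<c []. (\<lambda>w. w @ [i]) ` tree_verts (shift [i] c))"
  proof (rule set_eqI)
    fix v show "v \<in> tree_verts c \<longleftrightarrow> v \<in> insert [] (\<Union>i<c []. (\<lambda>w. w @ [i]) ` tree_verts (shift [i] c))"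
      by (cases v rule: rev_cases) (auto simp: tree_snoc)
  qed
  show ?thesis by (subst eq) (auto simp: finite_image_iff inj_on_def)
qed

text \<open>The two infinite branches are the material for the subgraph on which WSM fails.\<close>

definition branching :: "(nat list \<Rightarrow> nat) \<Rightarrow> bool" where
  "branching c \<longleftrightarrow> (\<exists>v. v \<in> tree_verts c \<and> (\<exists>i. i < c v \<and> (\<exists>j. j < c v \<and> i \<noteq> j \<and>
     infinite (tree_verts (shift (i # v) c)) \<and> infinite (tree_verts (shift (j # v) c)))))"

lemma branching_shift:
  assumes "branching (shift [i] c)" "i < c []" shows "branching c"
proof -
  from assms(1) obtain v k j where v: "v \<in> tree_verts (shift [i] c)"
    and kj: "k < c (v @ [i])" "j < c (v @ [i])" "k \<noteq> j"
    and inf: "infinite (tree_verts (shift (k # v @ [i]) c))" "infinite (tree_verts (shift (j # v @ [i]) c))"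
    unfolding branching_def shift_simps append_Cons shift_apply by blast
  have "v @ [i] \<in> tree_verts c" using v assms(2) by (simp add: tree_snoc)
  thus ?thesis using kj inf unfolding branching_def by blast
qed

context poisson_gw begin

text \<open>A winning vertex is not critical and has no winning child, so its link can only lead to
  a critical child. The clause on the siblings fits \<open>prob_one_child_le\<close>.\<close>

lemma chain_winning_step:
  assumes "chain (Suc n) c" "winning c"
  shows "\<exists>i<c []. (chain n (shift [i] c) \<and> critical (shift [i] c)) \<and>
           (\<forall>j<c []. j \<noteq> i \<longrightarrow> \<not> winning (shift [j] c))"
proof -
  obtain i where "i < c []" "link c i" "chain n (shift [i] c)" using assms(1) by auto
  moreover have "\<not> winning (shift [j] c)" if "j < c []" for j
    using winning_child_losing[OF assms(2) that] not_winning_losing by blast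
  ultimately show ?thesis using winning_not_critical[OF assms(2)] unfolding link_def by blast
qed

text \<open>The link leads either to the unique winning child or to a critical child beside it. The
  second case fixes two children and calls for \<open>prob_two_children_le\<close>.\<close>

lemma chain_critical_step:
  assumes "chain (Suc n) c" "critical c"
  shows "(\<exists>i<c []. (chain n (shift [i] c) \<and> winning (shift [i] c)) \<and>
             (\<forall>j<c []. j \<noteq> i \<longrightarrow> \<not> winning (shift [j] c))) \<or>
         (\<exists>i<c []. \<exists>j<c []. i \<noteq> j \<and> (chain n (shift [i] c) \<and> critical (shift [i] c)) \<and>
             winning (shift [j] c) \<and>
             (\<forall>l<c []. l \<noteq> i \<and> l \<noteq> j \<longrightarrow> \<not> winning (shift [l] c)))"
proof -
  obtain i where i: "i < c []" "link c i" "chain n (shift [i] c)" using assms(1) by auto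
  obtain w where w: "w < c []" "winning (shift [w] c)"
    "\<And>j. j < c [] \<Longrightarrow> j \<noteq> w \<Longrightarrow> \<not> winning (shift [j] c)"
    using assms(2) unfolding critical_def by blast
  show ?thesis
  proof (cases "i = w")
    case True
    thus ?thesis using i w by blast
  next
    case False
    hence "critical (shift [i] c)"
      using i w(3)[OF i(1)] winning_not_critical assms(2) unfolding link_def by blast
    thus ?thesis using False i w by blast
  qed
qed

section \<open>Decay of the probability of long chains\<close>

definition crit_chain_prob :: "nat \<Rightarrow> real" where "crit_chain_prob n = P.prob {c. chain n c \<and> critical c}"
definition win_chain_prob :: "nat \<Rightarrow> real" where "win_chain_prob n = P.prob {c. chain n c \<and> winning c}"

lemma measurable_chain_types [measurable]:
  "Measurable.pred P (\<lambda>c. chain n c \<and> critical c)" "Measurable.pred P (\<lambda>c. chain n c \<and> winning c)"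
  "Measurable.pred P (\<lambda>c. \<not> winning c)"
  by measurable

lemma one_minus_prob_not_winning: "1 - P.prob {c. \<not> winning c} = win_prob"
  by (simp add: prob_not win_prob_def)

lemma measurable_one_child:
  assumes "Measurable.pred P A" "Measurable.pred P B"
  shows "Measurable.pred P (\<lambda>c. \<exists>i<c []. A (shift [i] c) \<and> (\<forall>j<c []. j \<noteq> i \<longrightarrow> B (shift [j] c)))"
proof -
  have [measurable]: "Measurable.pred P (\<lambda>c. A (shift v c))" "Measurable.pred P (\<lambda>c. B (shift v c))" for v
    by (rule measurable_pred_shift; fact)+
  show ?thesis by measurable
qed

lemma measurable_two_children:
  assumes "Measurable.pred P A" "Measurable.pred P A'" "Measurable.pred P B"
  shows "Measurable.pred P (\<lambda>c. \<exists>i<c []. \<exists>j<c []. i \<noteq> j \<and> A (shift [i] c) \<and> A' (shift [j] c) \<and>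
             (\<forall>l<c []. l \<noteq> i \<and> l \<noteq> j \<longrightarrow> B (shift [l] c)))"
proof -
  have [measurable]: "Measurable.pred P (\<lambda>c. A (shift v c))" "Measurable.pred P (\<lambda>c. A' (shift v c))"
     "Measurable.pred P (\<lambda>c. B (shift v c))" for v
    by (rule measurable_pred_shift; fact)+
  show ?thesis by measurable
qed

lemma exp_fixpoint: "win_prob = unlost_prob \<Longrightarrow> exp (- d * win_prob) = win_prob"
  using unlost_prob_eq by metis

text \<open>The factor is the derivative \<open>d * exp (- d * win_prob)\<close>; the fixed-point
  equation turns it into \<open>d * win_prob\<close>, the \<open>t\<close> of the
  introduction.\<close>

lemma win_chain_prob_Suc_le:
  assumes "win_prob = unlost_prob" shows "win_chain_prob (Suc n) \<le> d * win_prob * crit_chain_prob n"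
proof -
  have "win_chain_prob (Suc n) \<le> P.prob {c. \<exists>i<c []. (chain n (shift [i] c) \<and> critical (shift [i] c)) \<and>
           (\<forall>j<c []. j \<noteq> i \<longrightarrow> \<not> winning (shift [j] c))}"
    unfolding win_chain_prob_def
    by (rule P.finite_measure_mono[OF _ pred_sets[OF measurable_one_child[OF measurable_chain_types(1,3)]]])
       (use chain_winning_step in blast)
  also have "\<dots> \<le> d * crit_chain_prob n * exp (- d * (1 - P.prob {c. \<not> winning c}))"
    unfolding crit_chain_prob_def by (rule prob_one_child_le[OF measurable_chain_types(1,3)])
  also have "\<dots> = d * win_prob * crit_chain_prob n"
    unfolding one_minus_prob_not_winning exp_fixpoint[OF assms] by simp
  finally show ?thesis .
qed

lemma crit_chain_prob_Suc_le:
  assumes "win_prob = unlost_prob" shows "crit_chain_prob (Suc n) \<le> d * win_prob * win_chain_prob n + (d * win_prob)\<^sup>2 * crit_chain_prob n"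
proof -
  let ?A = "{c. \<exists>i<c []. (chain n (shift [i] c) \<and> winning (shift [i] c)) \<and>
             (\<forall>j<c []. j \<noteq> i \<longrightarrow> \<not> winning (shift [j] c))}"
  let ?B = "{c. \<exists>i<c []. \<exists>j<c []. i \<noteq> j \<and> (chain n (shift [i] c) \<and> critical (shift [i] c)) \<and>
             winning (shift [j] c) \<and>
             (\<forall>l<c []. l \<noteq> i \<and> l \<noteq> j \<longrightarrow> \<not> winning (shift [l] c))}"
  have A: "?A \<in> sets P" by (rule pred_sets[OF measurable_one_child[OF measurable_chain_types(2,3)]])
  have B: "?B \<in> sets P" by (rule pred_sets[OF measurable_two_children[OF measurable_chain_types(1) measurable_winning measurable_chain_types(3)]])
  have "crit_chain_prob (Suc n) \<le> P.prob (?A \<union> ?B)"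
    unfolding crit_chain_prob_def
    by (rule P.finite_measure_mono[OF _ sets.Un[OF A B]]) (use chain_critical_step in blast)
  moreover have "P.prob (?A \<union> ?B) \<le> P.prob ?A + P.prob ?B" by (rule measure_Un_le[OF A B])
  moreover have "P.prob ?A \<le> d * win_chain_prob n * exp (- d * (1 - P.prob {c. \<not> winning c}))"
    unfolding win_chain_prob_def by (rule prob_one_child_le[OF measurable_chain_types(2,3)])
  hence "P.prob ?A \<le> d * win_prob * win_chain_prob n"
    unfolding one_minus_prob_not_winning exp_fixpoint[OF assms] by (simp add: mult_ac)
  moreover have "P.prob ?B \<le> d ^ 2 * crit_chain_prob n * win_prob * exp (- d * (1 - P.prob {c. \<not> winning c}))"
    unfolding crit_chain_prob_def win_prob_def by (rule prob_two_children_le[OF measurable_chain_types(1) measurable_winning measurable_chain_types(3)])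
  hence "P.prob ?B \<le> (d * win_prob)\<^sup>2 * crit_chain_prob n"
    unfolding one_minus_prob_not_winning exp_fixpoint[OF assms]
    by (simp add: power2_eq_square mult_ac)
  ultimately show ?thesis by linarith
qed

lemma crit_chain_prob_Suc_antimono: "crit_chain_prob (Suc n) \<le> crit_chain_prob n"
  unfolding crit_chain_prob_def
  by (rule P.finite_measure_mono[OF _ pred_sets[OF measurable_chain_types(1)]]) (use chain_Suc_imp in blast)

text \<open>Over two generations, the passage from critical through winning back to critical
  contributes \<open>t\<^sup>2\<close>, where \<open>t = d * win_prob\<close>. A direct step between
  critical vertices contributes another \<open>t\<^sup>2\<close>, its spare generation being
  absorbed by monotonicity.\<close>

lemma crit_chain_prob_decay:
  assumes "win_prob = unlost_prob" shows "crit_chain_prob (2 * n) \<le> (2 * (d * win_prob)\<^sup>2) ^ n"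
proof (induction n)
  case 0 show ?case using P.prob_le_1 by (simp add: crit_chain_prob_def)
next
  case (Suc n)
  have da: "d * win_prob \<ge> 0" using d_pos by (simp add: win_prob_def)
  have "crit_chain_prob (2 * Suc n) \<le> d * win_prob * win_chain_prob (Suc (2 * n)) + (d * win_prob)\<^sup>2 * crit_chain_prob (Suc (2 * n))"
    using crit_chain_prob_Suc_le[OF assms, of "Suc (2 * n)"] by simp
  also have "\<dots> \<le> d * win_prob * (d * win_prob * crit_chain_prob (2 * n)) + (d * win_prob)\<^sup>2 * crit_chain_prob (2 * n)"
    using da by (intro add_mono mult_left_mono win_chain_prob_Suc_le assms crit_chain_prob_Suc_antimono) auto
  also have "\<dots> = 2 * (d * win_prob)\<^sup>2 * crit_chain_prob (2 * n)" by (simp add: power2_eq_square)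
  also have "\<dots> \<le> 2 * (d * win_prob)\<^sup>2 * (2 * (d * win_prob)\<^sup>2) ^ n" using Suc by (intro mult_left_mono) auto
  finally show ?case by simp
qed

lemma da_bound:
  assumes "win_prob = unlost_prob" "d < exp (1 / sqrt 2) / sqrt 2" shows "2 * (d * win_prob)\<^sup>2 < 1"
proof -
  have "d * win_prob < 1 / sqrt 2"
  proof (rule ccontr)
    assume "\<not> d * win_prob < 1 / sqrt 2"
    \<comment> \<open>At the fixed point \<open>d = t * exp t\<close> with
      \<open>t = d * win_prob\<close>, which increases with \<open>t\<close>; the value at
      \<open>t = 1 / sqrt 2\<close> is the stated threshold.\<close>
    hence "exp (1 / sqrt 2) * (1 / sqrt 2) \<le> exp (d * win_prob) * (d * win_prob)"
      by (intro mult_mono) auto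
    also have "\<dots> = d" using exp_fixpoint[OF assms(1)] by (simp add: exp_minus field_simps)
    finally show False using assms(2) by simp
  qed
  moreover have "0 \<le> d * win_prob" using d_pos by (simp add: win_prob_def)
  ultimately have "(d * win_prob)\<^sup>2 < (1 / sqrt 2)\<^sup>2" by (intro power_strict_mono) auto
  thus ?thesis by (simp add: power_divide)
qed

lemma critical_value_less_e: "exp (1 / sqrt 2) / sqrt 2 < exp (1::real)"
proof -
  have "1 < sqrt (2::real)" by simp
  hence "exp (1 / sqrt 2) / sqrt 2 < exp (1 / sqrt 2) / 1" by (intro divide_strict_left_mono) auto
  also have "\<dots> \<le> exp (1::real)" using \<open>1 < sqrt 2\<close> by simp
  finally show ?thesis .
qed

lemma AE_chain_terminates:
  assumes "d < exp (1 / sqrt 2) / sqrt 2" shows "AE c in P. \<exists>n. \<not> chain n c"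
proof -
  have ab: "win_prob = unlost_prob" using assms critical_value_less_e by (intro win_prob_eq_unlost_prob) linarith
  let ?r = "2 * (d * win_prob)\<^sup>2"
  let ?S = "{c. \<forall>n. chain n c}"
  have S: "?S \<in> sets P" by (intro pred_sets) measurable
  have da: "d * win_prob \<ge> 0" using d_pos by (simp add: win_prob_def)
  have bound: "P.prob ?S \<le> ?r ^ n * (1 + d * win_prob)" for n
  proof -
    \<comment> \<open>The first link already forces the root to be critical or winning. The extra
      link for a winning root is spent on stepping to a critical child.\<close>
    have "?S \<subseteq> {c. chain (2 * n) c \<and> critical c} \<union> {c. chain (Suc (2 * n)) c \<and> winning c}"
    proof
      fix c assume c: "c \<in> ?S"
      hence "chain (Suc 0) c" by blast
      hence "critical c \<or> winning c" by (auto simp: link_def)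
      thus "c \<in> {c. chain (2 * n) c \<and> critical c} \<union> {c. chain (Suc (2 * n)) c \<and> winning c}"
        using c by blast
    qed
    hence "P.prob ?S \<le> P.prob ({c. chain (2 * n) c \<and> critical c} \<union> {c. chain (Suc (2 * n)) c \<and> winning c})"
      by (intro P.finite_measure_mono sets.Un pred_sets measurable_chain_types)
    also have "\<dots> \<le> crit_chain_prob (2 * n) + win_chain_prob (Suc (2 * n))"
      unfolding crit_chain_prob_def win_chain_prob_def by (intro measure_Un_le pred_sets measurable_chain_types)
    also have "\<dots> \<le> crit_chain_prob (2 * n) + d * win_prob * crit_chain_prob (2 * n)" using win_chain_prob_Suc_le[OF ab] by simp
    also have "\<dots> = crit_chain_prob (2 * n) * (1 + d * win_prob)" by (simp add: algebra_simps)
    also have "\<dots> \<le> ?r ^ n * (1 + d * win_prob)" using da crit_chain_prob_decay[OF ab] by (intro mult_right_mono) auto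
    finally show ?thesis .
  qed
  have "(\<lambda>n. ?r ^ n * (1 + d * win_prob)) \<longlonglongrightarrow> 0 * (1 + d * win_prob)"
    using da_bound[OF ab assms] by (intro tendsto_mult tendsto_const LIMSEQ_power_zero) auto
  hence "P.prob ?S \<le> 0 * (1 + d * win_prob)"
    by (rule LIMSEQ_le_const) (use bound in blast)
  hence "P.prob ?S = 0" using measure_nonneg[of P ?S] by linarith
  hence "?S \<in> null_sets P" using S by (intro null_setsI) (auto simp: P.emeasure_eq_measure)
  from AE_not_in[OF this] show ?thesis by eventually_elim auto
qed

text \<open>If the two limits agreed, \<open>peel_prob\<close> would converge to the fixed point.
  For \<open>d > exp 1\<close> the fixed point repels: the distance to it is never zero and
  eventually stops decreasing.\<close>

lemma win_prob_less_unlost_prob: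
  assumes "d > exp 1" shows "win_prob < unlost_prob"
proof (rule ccontr)
  assume "\<not> win_prob < unlost_prob"
  hence ab: "win_prob = unlost_prob" using win_prob_le_unlost_prob by simp
  have a_fix: "exp (- d * win_prob) = win_prob" by (rule exp_fixpoint[OF ab])
  have a0: "win_prob > 0" by (subst a_fix[symmetric]) simp
  \<comment> \<open>The modulus of the derivative at the fixed point. Were it at most 1, then
    \<open>win_prob\<close> would be at least \<open>exp (- 1)\<close> and
    \<open>d * win_prob\<close> would exceed 1 after all.\<close>
  have da: "d * win_prob > 1"
  proof (rule ccontr)
    assume "\<not> d * win_prob > 1"
    hence "exp (- 1) \<le> exp (- d * win_prob)" by simp
    hence "exp (- 1) \<le> win_prob" unfolding a_fix .
    hence "exp 1 * exp (- 1) < d * win_prob" using assms a0 by (intro mult_less_le_imp_less) auto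
    thus False using \<open>\<not> d * win_prob > 1\<close> by (simp flip: exp_add)
  qed
  have ne: "peel_prob k \<noteq> win_prob" for k
  proof (induction k)
    case 0
    have "win_prob < 1" using a0 d_pos by (subst a_fix[symmetric]) simp
    thus ?case by (simp add: peel_prob_0)
  next
    case (Suc k)
    have "exp (- d * peel_prob k) \<noteq> exp (- d * win_prob)" using Suc d_pos by simp
    thus ?case unfolding a_fix peel_prob_Suc .
  qed
  have lim: "peel_prob \<longlonglongrightarrow> win_prob"
  proof (rule topological_tendstoI)
    fix S assume S: "open S" "win_prob \<in> S"
    have "(\<lambda>k. peel_prob (2 * k)) \<longlonglongrightarrow> win_prob" using peel_prob_even_tendsto ab by simp
    from topological_tendstoD[OF this S] topological_tendstoD[OF peel_prob_odd_tendsto S]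
    obtain N M where N: "\<And>k. k \<ge> N \<Longrightarrow> peel_prob (2 * k) \<in> S" and M: "\<And>k. k \<ge> M \<Longrightarrow> peel_prob (2 * k + 1) \<in> S"
      by (auto simp: eventually_sequentially)
    have "peel_prob k \<in> S" if "k \<ge> 2 * (N + M)" for k
    proof (cases "even k")
      case True
      thus ?thesis using N[of "k div 2"] that by simp
    next
      case False
      hence "2 * (k div 2) + 1 = k" by presburger
      moreover have "k div 2 \<ge> M" using div_le_mono[OF that, of 2] by simp
      ultimately show ?thesis using M[of "k div 2"] by simp
    qed
    thus "\<forall>\<^sub>F k in sequentially. peel_prob k \<in> S" by (auto simp: eventually_sequentially)
  qed
  hence "(\<lambda>k. d * peel_prob k) \<longlonglongrightarrow> d * win_prob" by (intro tendsto_intros)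
  hence "eventually (\<lambda>k. d * peel_prob k > 1) sequentially" using da by (rule order_tendstoD)
  then obtain K where K: "\<And>k. k \<ge> K \<Longrightarrow> d * peel_prob k > 1" by (auto simp: eventually_sequentially)
  \<comment> \<open>The derivative has its smallest modulus at the right end \<open>v\<close>, so a
    modulus of at least 1 there suffices.\<close>
  have expand: "v - u \<le> exp (- d * u) - exp (- d * v)" if "u \<le> v" "d * exp (- d * v) \<ge> 1" for u v
  proof -
    have "1 * (v - u) \<le> (d * exp (- d * v)) * (v - u)" using that by (intro mult_right_mono) auto
    also have "\<dots> = exp (- d * v) * (d * (v - u))" by simp
    also have "\<dots> \<le> exp (- d * v) * (exp (d * (v - u)) - 1)"
      using exp_ge_add_one_self[of "d * (v - u)"] by (intro mult_left_mono) (simp_all add: algebra_simps)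
    also have "\<dots> = exp (- d * u) - exp (- d * v)"
      by (simp add: algebra_simps flip: exp_add)
    finally show ?thesis by simp
  qed
  have step: "\<bar>peel_prob k - win_prob\<bar> \<le> \<bar>peel_prob (Suc k) - win_prob\<bar>" if "k \<ge> K" for k
  proof (cases "peel_prob k \<le> win_prob")
    case True
    have "d * exp (- d * win_prob) \<ge> 1" using da a_fix by simp
    from expand[OF True this] show ?thesis using True peel_prob_Suc[of k] a_fix by linarith
  next
    case False
    have "d * exp (- d * peel_prob k) \<ge> 1" using K[of "Suc k"] that peel_prob_Suc[of k] by simp
    from expand[OF _ this, of win_prob] show ?thesis using False peel_prob_Suc[of k] a_fix by linarith
  qed
  have "\<bar>peel_prob K - win_prob\<bar> \<le> \<bar>peel_prob k - win_prob\<bar>" if "k \<ge> K" for k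
    using that
  proof (induction k rule: dec_induct)
    case (step n)
    thus ?case using \<open>\<And>k. K \<le> k \<Longrightarrow> \<bar>peel_prob k - win_prob\<bar> \<le> \<bar>peel_prob (Suc k) - win_prob\<bar>\<close>[of n] by linarith
  qed simp
  moreover have "(\<lambda>k. \<bar>peel_prob k - win_prob\<bar>) \<longlonglongrightarrow> 0"
    using lim by (intro tendsto_rabs_zero LIM_zero)
  ultimately have "\<bar>peel_prob K - win_prob\<bar> \<le> 0"
    by (intro LIMSEQ_le_const) auto
  thus False using ne by simp
qed

lemma prob_two_undetermined:
  assumes "d > exp 1"
  shows "P.prob {c. c [] = 2 \<and> (\<forall>i<2. \<not> winning (shift [i] c) \<and> \<not> losing (shift [i] c))} > 0"
proof -
  have "P.prob {c. c [] = 2 \<and> (\<forall>i<2. \<not> winning (shift [i] c) \<and> \<not> losing (shift [i] c))} =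
     pmf (poisson_pmf d) 2 * (\<Prod>i::nat<2. P.prob {c. \<not> winning c \<and> \<not> losing c})"
    by (rule prob_branch) measurable
  also have "\<dots> > 0" using win_prob_less_unlost_prob[OF assms] d_pos by (simp add: prob_undetermined)
  finally show ?thesis .
qed

section \<open>Infinite Poisson trees branch almost surely\<close>

lemma measurable_in_tree [measurable]: "Measurable.pred P (\<lambda>c. v \<in> tree_verts c)"
proof (induction v)
  case (Cons i v)
  note Cons [measurable]
  show ?case unfolding tree_Cons by measurable
qed simp

lemma measurable_finite_tree [measurable]: "Measurable.pred P (\<lambda>c. finite (tree_verts c))"
proof -
  \<comment> \<open>Rephrased with a quantifier over lists, a countable type, so that measurability
    is automatic.\<close>
  have eq: "finite (tree_verts c) \<longleftrightarrow> (\<exists>xs. \<forall>v. v \<in> tree_verts c \<longrightarrow> v \<in> set xs)" for c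
    by (metis List.finite_set finite_list finite_subset subsetI)
  show ?thesis unfolding eq by measurable
qed

lemma measurable_branching [measurable]: "Measurable.pred P branching"
proof -
  have [measurable]: "Measurable.pred P (\<lambda>c. finite (tree_verts (shift v c)))" for v
    by (rule measurable_pred_shift) measurable
  show ?thesis unfolding branching_def[abs_def] by measurable
qed

text \<open>An infinite tree without branching has exactly one infinite root branch, again without
  branching. Hence \<open>q \<le> (d * exp (- d * s)) * q\<close>, where the factor is the
  derivative of the generating function at the extinction probability \<open>1 - s\<close>, below 1
  if \<open>s > 0\<close>.\<close>

lemma AE_infinite_branching: "AE c in P. infinite (tree_verts c) \<longrightarrow> branching c"
proof -
  define s where "s = P.prob {c. infinite (tree_verts c)}"
  let ?Q = "\<lambda>c. infinite (tree_verts c) \<and> \<not> branching c"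
  define q where "q = P.prob {c. ?Q c}"
  have mQ: "Measurable.pred P ?Q" by measurable
  have fin: "1 - P.prob {c. finite (tree_verts c)} = s"
    unfolding s_def by (simp add: prob_not measurable_finite_tree)
  have "P.prob {c. finite (tree_verts c)} = P.prob {c. \<forall>i<c []. finite (tree_verts (shift [i] c))}"
    by (rule arg_cong[of _ _ P.prob]) (use finite_tree_iff in blast)
  also have "\<dots> = exp (- d * s)"
    unfolding fin[symmetric] by (rule prob_all_children) measurable
  finally have s: "1 - s = exp (- d * s)" using fin by simp
  have step: "\<exists>i<c []. ?Q (shift [i] c) \<and> (\<forall>j<c []. j \<noteq> i \<longrightarrow> finite (tree_verts (shift [j] c)))"
    if Qc: "?Q c" for c
  proof -
    obtain i where i: "i < c []" "infinite (tree_verts (shift [i] c))"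
      using Qc finite_tree_iff[of c] by blast
    have "finite (tree_verts (shift [j] c))" if "j < c []" "j \<noteq> i" for j
    proof (rule ccontr)
      assume "infinite (tree_verts (shift [j] c))"
      hence "branching c" unfolding branching_def using i that tree_Nil by blast
      thus False using Qc by blast
    qed
    moreover have "\<not> branching (shift [i] c)" using branching_shift[of i c] i(1) Qc by blast
    ultimately show ?thesis using i by blast
  qed
  have "q \<le> P.prob {c. \<exists>i<c []. ?Q (shift [i] c) \<and>
      (\<forall>j<c []. j \<noteq> i \<longrightarrow> finite (tree_verts (shift [j] c)))}"
    unfolding q_def
  proof (rule P.finite_measure_mono)
    show "{c. \<exists>i<c []. ?Q (shift [i] c) \<and>
      (\<forall>j<c []. j \<noteq> i \<longrightarrow> finite (tree_verts (shift [j] c)))} \<in> sets P"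
      by (rule pred_sets, rule measurable_one_child[of ?Q "\<lambda>c. finite (tree_verts c)"], rule mQ) measurable
  qed (use step in blast)
  also have "\<dots> \<le> d * q * exp (- d * (1 - P.prob {c. finite (tree_verts c)}))"
    unfolding q_def by (rule prob_one_child_le[OF mQ]) measurable
  finally have q: "q \<le> (d * exp (- d * s)) * q" by (simp add: fin mult_ac)
  have "q = 0"
  proof (cases "s = 0")
    case True
    have "q \<le> s" unfolding q_def s_def
      by (intro P.finite_measure_mono pred_sets) (auto intro: measurable_finite_tree)
    thus ?thesis using True by (simp add: q_def measure_le_0_iff)
  next
    case False
    hence s0: "s > 0" by (simp add: s_def less_le)
    have "1 + d * s < exp (d * s)" using False d_pos by (intro exp_gt_add_one) simp
    hence "(1 + d * s) * exp (- d * s) < exp (d * s) * exp (- d * s)" by (intro mult_strict_right_mono) auto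
    hence "(1 + d * s) * exp (- d * s) < 1" by (simp flip: exp_add)
    hence "s * (d * exp (- d * s)) < 1 - exp (- d * s)" by (simp only: algebra_simps)
    hence "s * (d * exp (- d * s)) < s * 1" using s by linarith
    hence "d * exp (- d * s) < 1" using s0 by simp
    moreover have "q \<ge> 0" by (simp add: q_def)
    ultimately show ?thesis using q by (metis less_eq_real_def mult_le_cancel_right1 not_le)
  qed
  hence "{c. ?Q c} \<in> null_sets P" unfolding q_def using mQ
    by (intro null_setsI pred_sets) (auto simp: P.emeasure_eq_measure)
  from AE_not_in[OF this] show ?thesis by eventually_elim auto
qed

end

section \<open>Failure of weak spatial mixing\<close>

lemma tv_dist_self: "tv_dist p p = 0"
  by (simp add: tv_dist_def)

lemma tv_dist_ge: "\<bar>measure_pmf.prob p A - measure_pmf.prob q A\<bar> \<le> tv_dist p q"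
  unfolding tv_dist_def
proof (rule cSUP_upper)
  have "\<bar>measure_pmf.prob p A - measure_pmf.prob q A\<bar> \<le> 1" for A
    using measure_pmf.prob_le_1[of p A] measure_pmf.prob_le_1[of q A]
      measure_nonneg[of p A] measure_nonneg[of q A] by linarith
  thus "bdd_above (range (\<lambda>A. \<bar>measure_pmf.prob p A - measure_pmf.prob q A\<bar>))"
    by (intro bdd_aboveI2)
qed simp

lemma marginal_const:
  assumes "finite \<Psi>" "boundary_condition E \<Psi> \<sigma>" "\<And>I. I \<in> hc_max_configs E \<Psi> \<sigma> \<Longrightarrow> I \<inter> \<Lambda> = L"
  shows "marginal \<Lambda> (hc_measure E \<Psi> \<sigma>) = return_pmf L"
proof -
  have "marginal \<Lambda> (hc_measure E \<Psi> \<sigma>) = map_pmf (\<lambda>_. L) (hc_measure E \<Psi> \<sigma>)"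
    unfolding marginal_def hc_measure_def
    by (rule map_pmf_cong[OF refl])
       (simp add: set_pmf_of_set hc_max_configs_finite hc_max_configs_nonempty assms)
  thus ?thesis by (simp add: map_pmf_const)
qed

text \<open>\<open>peel\<close> relative to a vertex set, because the subgraphs used against SSM
  need not be of the form \<open>tree_verts c\<close>.\<close>

primrec peel_in :: "nat list set \<Rightarrow> nat \<Rightarrow> nat list \<Rightarrow> bool" where
  "peel_in V 0 v = True"
| "peel_in V (Suc k) v = (\<forall>i. i # v \<in> V \<longrightarrow> \<not> peel_in V k (i # v))"

lemma relpow_length: "(x, y) \<in> forest_edges V ^^ k \<Longrightarrow> length y \<le> length x + k"
  by (induction k arbitrary: y) (fastforce elim!: forest_edges_cases)+

context
  fixes V :: "nat list set" and h :: nat and \<Psi> :: "nat list set"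
  defines "\<Psi> \<equiv> {v \<in> V. length v \<le> h}"
begin

lemma boundary_length: "v \<in> boundary (forest_edges V) \<Psi> \<Longrightarrow> length v = h"
  by (auto simp: boundary_def \<Psi>_def elim!: forest_edges_cases)

lemma boundaryI: "i # v \<in> V \<Longrightarrow> v \<in> V \<Longrightarrow> length v = h \<Longrightarrow> v \<in> boundary (forest_edges V) \<Psi>"
  using forest_edgesI(1)[of v V i] by (auto simp: boundary_def \<Psi>_def)

lemma peel_in_certificate_occupied:
  assumes "v \<in> V" "length v + k = h"
  shows "(peel_in V k v \<longrightarrow> win V \<Psi> (boundary (forest_edges V) \<Psi>) v) \<and>
         (\<not> peel_in V k v \<longrightarrow> lose V \<Psi> (boundary (forest_edges V) \<Psi>) v)"
  using assms
proof (induction k arbitrary: v)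
  case 0
  show ?case
  proof (cases "v \<in> boundary (forest_edges V) \<Psi>")
    case False
    \<comment> \<open>A vertex of depth \<open>h\<close> without children in \<open>V\<close> is not
      on the boundary, but wins vacuously.\<close>
    have "i # v \<notin> V" for i using False boundaryI[of i v] 0 by auto
    hence "win V \<Psi> (boundary (forest_edges V) \<Psi>) v"
      using False 0 by (intro win_inner) (auto simp: \<Psi>_def)
    thus ?thesis by simp
  qed (simp add: win_boundary)
next
  case (Suc k)
  have v: "v \<in> \<Psi> - boundary (forest_edges V) \<Psi>"
    using Suc.prems boundary_length[of v] by (auto simp: \<Psi>_def)
  have IH: "(peel_in V k (i # v) \<longrightarrow> win V \<Psi> (boundary (forest_edges V) \<Psi>) (i # v)) \<and>
         (\<not> peel_in V k (i # v) \<longrightarrow> lose V \<Psi> (boundary (forest_edges V) \<Psi>) (i # v))" if "i # v \<in> V" for i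
    using Suc.IH[OF that] Suc.prems by simp
  show ?case
    using IH win_inner[OF v] lose_inner[OF v] unfolding peel_in.simps by blast
qed

text \<open>A vacant boundary vertex is losing, as if its children one level further down were
  declared winning; this accounts for \<open>Suc k\<close>.\<close>

lemma peel_in_certificate_empty:
  assumes "v \<in> V" "length v + k = h"
  shows "(peel_in V (Suc k) v \<longrightarrow> win V \<Psi> {} v) \<and> (\<not> peel_in V (Suc k) v \<longrightarrow> lose V \<Psi> {} v)"
  using assms
proof (induction k arbitrary: v)
  case 0
  show ?case
  proof (cases "v \<in> boundary (forest_edges V) \<Psi>")
    case True
    then obtain i where "i # v \<in> V"
      by (auto simp: boundary_def \<Psi>_def elim!: forest_edges_cases)
    thus ?thesis using True by (auto intro: lose_boundary)
  next
    case False
    have "i # v \<notin> V" for i using False boundaryI[of i v] 0 by auto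
    hence "win V \<Psi> {} v"
      using False 0 by (intro win_inner) (auto simp: \<Psi>_def)
    thus ?thesis using \<open>\<And>i. i # v \<notin> V\<close> by simp
  qed
next
  case (Suc k)
  have v: "v \<in> \<Psi> - boundary (forest_edges V) \<Psi>"
    using Suc.prems boundary_length[of v] by (auto simp: \<Psi>_def)
  have IH: "(peel_in V (Suc k) (i # v) \<longrightarrow> win V \<Psi> {} (i # v)) \<and>
         (\<not> peel_in V (Suc k) (i # v) \<longrightarrow> lose V \<Psi> {} (i # v))" if "i # v \<in> V" for i
    using Suc.IH[OF that] Suc.prems by simp
  show ?case
    using IH win_inner[OF v] lose_inner[OF v] unfolding peel_in.simps(2)[of V "Suc k"] by blast
qed

end

text \<open>A fully occupied boundary makes \<open>r\<close> win, and \<open>r\<close> has no parent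
  in \<open>V\<close>, so it is occupied; an empty boundary makes two of its children win, so
  \<open>r\<close> is vacant. The marginals on \<open>{r}\<close> are distinct point masses at every
  radius.\<close>

lemma not_WSM_forest:
  assumes V: "r \<in> V" "i # r \<in> V" "j # r \<in> V" "i \<noteq> j" and top: "\<And>k u. r = k # u \<Longrightarrow> u \<notin> V"
    and fin: "\<And>n. finite {v \<in> V. length v \<le> n}"
    and par: "\<And>n. peel_in V (2 * n) r" "\<And>n. peel_in V (2 * n) (i # r)" "\<And>n. peel_in V (2 * n) (j # r)"
  shows "\<not> WSM V (forest_edges V)"
proof
  assume W: "WSM V (forest_edges V)"
  \<comment> \<open>An even depth below \<open>r\<close>, raised by 2 so that already for
    \<open>n = 0\<close> the vertex \<open>r\<close> is interior and its children have remaining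
    depth \<open>2 * n + 1\<close>.\<close>
  define h where "h n = length r + (2 * n + 2)" for n
  define \<Psi> where "\<Psi> n = {v \<in> V. length v \<le> h n}" for n
  let ?E = "forest_edges V"
  let ?B = "\<lambda>n. boundary ?E (\<Psi> n)"
  have bl: "length v = h n" if "v \<in> ?B n" for v n
    using boundary_length[of v V "h n"] that by (simp add: \<Psi>_def)
  have "(x, y) \<notin> ?E" if "x \<in> ?B n" "y \<in> ?B n" for x y n
    using bl[OF that(1)] bl[OF that(2)] by (auto elim!: forest_edges_cases)
  hence bc: "boundary_condition ?E (\<Psi> n) (?B n)" "boundary_condition ?E (\<Psi> n) {}" for n
    by (simp_all add: boundary_condition_def indep_def)
  have reg: "forest_region V (\<Psi> n)" for n
    unfolding forest_region_def \<Psi>_def using fin by auto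
  have dist: "(\<lambda>n. set_gdist ?E {r} (?B n)) \<longlonglongrightarrow> \<infinity>"
  proof -
    have "enat n \<le> set_gdist ?E {r} (?B n)" for n
      unfolding set_gdist_def
    proof (rule INF_greatest)
      fix k assume "k \<in> {n'. \<exists>x\<in>{r}. \<exists>y\<in>?B n. (x, y) \<in> ?E ^^ n'}"
      then obtain y where "y \<in> ?B n" "(r, y) \<in> ?E ^^ k" by auto
      hence "h n \<le> length r + k" using relpow_length bl by metis
      thus "enat n \<le> enat k" by (simp add: h_def)
    qed
    note ge = this
    show ?thesis
    proof (rule order_tendstoI)
      fix a :: enat assume "a < \<infinity>"
      then obtain m where a: "a = enat m" by (cases a) auto
      have "a < set_gdist ?E {r} (?B n)" if "m < n" for n
        using ge[of n] that a by (metis enat_ord_simps(2) less_le_trans)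
      thus "\<forall>\<^sub>F n in sequentially. a < set_gdist ?E {r} (?B n)"
        by (rule eventually_mono[OF eventually_gt_at_top[of m]])
    qed simp
  qed
  have occ: "r \<in> I" if I: "I \<in> hc_max_configs ?E (\<Psi> n) (?B n)" for I n
  proof -
    interpret forest_region V "\<Psi> n" "?B n" by (rule reg)
    have "win V (\<Psi> n) (?B n) r"
      using peel_in_certificate_occupied[of r V "2 * n + 2" "h n"] par(1)[of "Suc n"] V
      by (simp add: h_def \<Psi>_def)
    thus ?thesis
    proof (rule win_in_max[OF _ I])
      fix k u assume "r = k # u"
      hence "u \<notin> V" by (rule top)
      thus "u \<notin> I" using I sub by (auto simp: hc_max_configs_def hc_configs_def)
    qed
  qed
  have unocc: "r \<notin> I" if I: "I \<in> hc_max_configs ?E (\<Psi> n) {}" for I n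
  proof -
    interpret forest_region V "\<Psi> n" "{}" by (rule reg)
    have w: "win V (\<Psi> n) {} (k # r)" if "k # r \<in> V" "peel_in V (2 * Suc n) (k # r)" for k
      using peel_in_certificate_empty[of "k # r" V "2 * n + 1" "h n"] that
      by (simp add: h_def \<Psi>_def)
    have "r \<in> \<Psi> n - ?B n" using V bl[of r n] by (auto simp: \<Psi>_def h_def)
    thus ?thesis
      by (rule two_wins_notin_max[OF _ V(4,2,3) w[OF V(2) par(2)] w[OF V(3) par(3)] I])
  qed
  let ?tv = "\<lambda>n. tv_dist (marginal {r} (hc_measure ?E (\<Psi> n) (?B n)))
                        (marginal {r} (hc_measure ?E (\<Psi> n) {}))"
  have fin\<Psi>: "finite (\<Psi> n)" for n using fin by (simp add: \<Psi>_def)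
  have "?tv \<longlonglongrightarrow> 0"
    using W[unfolded WSM_def, rule_format, of "{r}" \<Psi> ?B "\<lambda>_. {}"] bc dist fin\<Psi> V(1)
    by (auto simp: \<Psi>_def h_def)
  moreover have "1 \<le> ?tv n" for n
  proof -
    have "marginal {r} (hc_measure ?E (\<Psi> n) (?B n)) = return_pmf {r}"
      by (rule marginal_const[OF fin\<Psi> bc(1)]) (use occ in auto)
    moreover have "marginal {r} (hc_measure ?E (\<Psi> n) {}) = return_pmf {}"
      by (rule marginal_const[OF fin\<Psi> bc(2)]) (use unocc in auto)
    ultimately show ?thesis
      using tv_dist_ge[of "return_pmf {r}" "{{r}}" "return_pmf {}"] by simp
  qed
  ultimately have "(1::real) \<le> 0" by (intro LIMSEQ_le_const[of ?tv]) auto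
  thus False by simp
qed

section \<open>Trees and subgraphs on which WSM fails\<close>

lemma finite_tree_levels: "finite {v \<in> tree_verts c. length v \<le> n}"
proof (induction n)
  case (Suc n)
  have "{v \<in> tree_verts c. length v \<le> Suc n} \<subseteq>
      insert [] (\<Union>v\<in>{v \<in> tree_verts c. length v \<le> n}. (\<lambda>i. i # v) ` {..<c v})"
  proof
    fix v assume "v \<in> {v \<in> tree_verts c. length v \<le> Suc n}"
    thus "v \<in> insert [] (\<Union>v\<in>{v \<in> tree_verts c. length v \<le> n}. (\<lambda>i. i # v) ` {..<c v})"
      by (cases v) auto
  qed
  thus ?case by (rule finite_subset) (use Suc in auto)
qed simp

lemma not_SSM_branching:
  assumes "branching c" shows "\<not> SSM (tree_verts c) (tree_edges c)"
proof -
  obtain v i j where v: "v \<in> tree_verts c" and ij: "i < c v" "j < c v" "i \<noteq> j"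
    and inf: "infinite (tree_verts (shift (i # v) c))" "infinite (tree_verts (shift (j # v) c))"
    using assms unfolding branching_def by blast
  \<comment> \<open>The proper descendants of \<open>v\<close> with infinite subtree. Each has a
    child of the same kind, so no leaf remains and \<open>peel_in\<close> depends on the parity
    alone.\<close>
  define R where "R = {u \<in> tree_verts c. length v < length u \<and> u \<in> below v \<and> infinite (tree_verts (shift u c))}"
  define V where "V = insert v R"
  have R: "i # v \<in> R" "j # v \<in> R"
    using v ij inf below_Cons below_self by (auto simp: R_def)
  have VT: "V \<subseteq> tree_verts c" using v by (auto simp: V_def R_def)
  have closed: "k # u \<in> R" if "k # u \<in> V" "u \<in> V" for k u
    using that by (auto simp: V_def R_def dest!: below_length)
  have child: "\<exists>k. k # u \<in> R" if u: "u \<in> R" for u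
  proof -
    have "infinite (tree_verts (shift u c))" using u by (simp add: R_def)
    then obtain k where "k < c u" "infinite (tree_verts (shift (k # u) c))"
      using finite_tree_iff[of "shift u c"] by auto
    thus ?thesis using u below_Cons by (auto simp: R_def below_def)
  qed
  have par: "peel_in V k u \<longleftrightarrow> even k" if "u \<in> R" for k u
    using that
  proof (induction k arbitrary: u)
    case (Suc k)
    have "peel_in V k (l # u) \<longleftrightarrow> even k" if "l # u \<in> V" for l
      using Suc closed[OF that] by (simp add: V_def)
    moreover obtain l where "l # u \<in> V" using child[OF Suc.prems] by (auto simp: V_def)
    ultimately show ?case by (simp only: peel_in.simps even_Suc) blast
  qed simp
  have "peel_in V (2 * n) v" for n
  proof (cases n)
    case (Suc m)
    have "\<not> peel_in V (2 * m + 1) (l # v)" if "l # v \<in> V" for l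
      using par[OF closed[OF that]] by (simp add: V_def del: peel_in.simps)
    hence "peel_in V (Suc (2 * m + 1)) v" unfolding peel_in.simps by blast
    thus ?thesis using Suc by simp
  qed simp
  moreover have "u \<notin> V" if "v = k # u" for k u
    using that by (auto simp: V_def R_def)
  moreover have "finite {u \<in> V. length u \<le> n}" for n
    by (rule finite_subset[OF _ finite_tree_levels[of c n]]) (use VT in auto)
  ultimately have "\<not> WSM V (forest_edges V)"
    using R ij par by (intro not_WSM_forest[of v V i j]) (auto simp: V_def)
  moreover have "is_subgraph V (forest_edges V) (tree_verts c) (tree_edges c)"
    unfolding tree_edges_eq by (rule is_subgraph_forest_edges[OF VT])
  ultimately show ?thesis unfolding SSM_def by blast
qed

lemma peel_in_tree: "v \<in> tree_verts c \<Longrightarrow> peel_in (tree_verts c) k v \<longleftrightarrow> peel k (shift v c)"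
  by (induction k arbitrary: v) (auto simp: shift_apply)

text \<open>Not losing gives \<open>peel\<close> at all even depths at the two children; not winning
  denies it at odd depths, which gives it at even depths at the root.\<close>

lemma not_WSM_undetermined:
  assumes "c [] = 2" "\<And>i. i < 2 \<Longrightarrow> \<not> winning (shift [i] c) \<and> \<not> losing (shift [i] c)"
  shows "\<not> WSM (tree_verts c) (tree_edges c)"
  unfolding tree_edges_eq
proof (rule not_WSM_forest[of "[]" _ 0 1])
  show "peel_in (tree_verts c) (2 * n) [0]" "peel_in (tree_verts c) (2 * n) [1]" for n
    using assms by (auto simp: peel_in_tree losing_def)
  show "peel_in (tree_verts c) (2 * n) []" for n
  proof (cases n)
    case (Suc m)
    have "\<not> peel (2 * m + 1) (shift [i] c)" if "i < 2" for i
      using assms(2)[OF that] by (simp only: winning_def) blast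
    thus ?thesis using assms(1) Suc by (simp add: peel_in_tree)
  qed simp
qed (use assms finite_tree_levels in auto)

lemma peel_finite_tree:
  assumes "v \<in> tree_verts c" "\<And>u. u \<in> tree_verts c \<Longrightarrow> length u < n" "n \<le> k + length v"
  shows "peel k (shift v c) \<longleftrightarrow> peel (Suc k) (shift v c)"
  using assms
proof (induction k arbitrary: v)
  case 0
  thus ?case by fastforce
next
  case (Suc k)
  have "peel k (shift (i # v) c) \<longleftrightarrow> peel (Suc k) (shift (i # v) c)" if "i < c v" for i
    using that Suc.prems by (intro Suc.IH) auto
  thus ?case by (simp add: peel.simps(2)[of "Suc k"] peel.simps(2)[of k "shift v c"] del: peel.simps)
qed

text \<open>Beyond the height of the tree \<open>peel\<close> no longer depends on the depth, so
  even and odd depths agree. Contrapositively, an undetermined branch is infinite.\<close>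

lemma finite_tree_determined:
  assumes "finite (tree_verts c)" shows "winning c \<or> losing c"
proof -
  obtain n where n: "\<And>u. u \<in> tree_verts c \<Longrightarrow> length u < n"
    using finite_nat_bounded[of "length ` tree_verts c"] assms by auto
  hence "peel (2 * n) c \<longleftrightarrow> peel (2 * n + 1) c" using peel_finite_tree[of "[]" c n "2 * n"] by simp
  thus ?thesis unfolding winning_def losing_def by blast
qed


section \<open>Uniform distributions with an exchangeable part\<close>

lemma pmf_of_set_times:
  assumes "finite A" "finite B" "A \<noteq> {}" "B \<noteq> {}"
  shows "pmf_of_set (A \<times> B) = pair_pmf (pmf_of_set A) (pmf_of_set B)"
  using assms
  by (intro pmf_eqI)
     (auto simp: pmf_pair pmf_of_set[OF assms(3,1)] pmf_of_set[OF assms(4,2)] indicator_def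
        card_cartesian_product)

text \<open>Free exchange makes \<open>M\<close> a product of the parts inside \<open>D\<close> and
  the parts outside, so the inside part is uniform on \<open>\<J>\<close>.\<close>

lemma map_pmf_of_set_exchangeable:
  assumes M: "finite M" "M \<noteq> {}" and D: "\<And>J. J \<in> \<J> \<Longrightarrow> J \<subseteq> D"
    and restrict: "\<And>I. I \<in> M \<Longrightarrow> I \<inter> D \<in> \<J>"
    and exchange: "\<And>I J. I \<in> M \<Longrightarrow> J \<in> \<J> \<Longrightarrow> (I - D) \<union> J \<in> M"
  shows "map_pmf (\<lambda>I. I \<inter> D) (pmf_of_set M) = pmf_of_set \<J>"
proof -
  define \<K> where "\<K> = (\<lambda>I. I - D) ` M"
  let ?h = "\<lambda>(J, K). J \<union> K"
  have "\<J> \<subseteq> (\<lambda>I. I \<inter> D) ` M"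
  proof
    fix J assume J: "J \<in> \<J>"
    obtain I where I: "I \<in> M" using M by blast
    have "J = ((I - D) \<union> J) \<inter> D" using D[OF J] by blast
    thus "J \<in> (\<lambda>I. I \<inter> D) ` M" using exchange[OF I J] by blast
  qed
  hence fin: "finite \<J>" "finite \<K>" using M(1) finite_surj by (auto simp: \<K>_def)
  have ne: "\<J> \<noteq> {}" "\<K> \<noteq> {}" using M(2) restrict by (auto simp: \<K>_def)
  have inj: "inj_on ?h (\<J> \<times> \<K>)"
  proof (rule inj_onI, clarify)
    fix J K J' K' assume h: "J \<in> \<J>" "J' \<in> \<J>" "K \<in> \<K>" "K' \<in> \<K>" "J \<union> K = J' \<union> K'"
    have "K \<inter> D = {}" "K' \<inter> D = {}" using h by (auto simp: \<K>_def)
    thus "J = J' \<and> K = K'" using h(5) D[OF h(1)] D[OF h(2)] by blast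
  qed
  have img: "?h ` (\<J> \<times> \<K>) = M"
  proof
    show "?h ` (\<J> \<times> \<K>) \<subseteq> M" using exchange by (auto simp: \<K>_def Un_commute)
    show "M \<subseteq> ?h ` (\<J> \<times> \<K>)"
    proof
      fix I assume "I \<in> M"
      hence "(I \<inter> D, I - D) \<in> \<J> \<times> \<K>" using restrict by (auto simp: \<K>_def)
      thus "I \<in> ?h ` (\<J> \<times> \<K>)" by (rule rev_image_eqI) auto
    qed
  qed
  have "map_pmf (\<lambda>I. I \<inter> D) (pmf_of_set M) = map_pmf (\<lambda>I. I \<inter> D) (map_pmf ?h (pmf_of_set (\<J> \<times> \<K>)))"
    using map_pmf_of_set_inj[OF inj] fin ne img by simp
  also have "\<dots> = map_pmf (\<lambda>p. ?h p \<inter> D) (pmf_of_set (\<J> \<times> \<K>))"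
    by (simp add: map_pmf_comp)
  also have "\<dots> = map_pmf fst (pmf_of_set (\<J> \<times> \<K>))"
  proof (rule map_pmf_cong[OF refl])
    fix p assume "p \<in> set_pmf (pmf_of_set (\<J> \<times> \<K>))"
    hence "p \<in> \<J> \<times> \<K>" using fin ne by (simp add: set_pmf_of_set)
    then obtain J I where p: "p = (J, I - D)" "J \<in> \<J>" by (auto simp: \<K>_def)
    thus "?h p \<inter> D = fst p" using D[OF p(2)] by auto
  qed
  also have "\<dots> = pmf_of_set \<J>"
    using fin ne by (simp add: pmf_of_set_times map_fst_pair_pmf)
  finally show ?thesis .
qed

section \<open>Distances and certificates in a region of the tree\<close>

lemma relpow_exit:
  assumes "(x, v) \<in> E ^^ k" "x \<in> \<Psi>" "v \<notin> \<Psi>"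
  shows "\<exists>j\<le>k. \<exists>y\<in>boundary E \<Psi>. (x, y) \<in> E ^^ j"
  using assms
proof (induction k arbitrary: v)
  case (Suc k)
  then obtain u where u: "(x, u) \<in> E ^^ k" "(u, v) \<in> E" by auto
  show ?case
  proof (cases "u \<in> \<Psi>")
    case True
    hence "u \<in> boundary E \<Psi>" using u Suc.prems by (auto simp: boundary_def)
    thus ?thesis using u(1) by (intro exI[of _ k]) auto
  next
    case False
    thus ?thesis using Suc.IH[OF u(1) Suc.prems(2)] le_Suc_eq by blast
  qed
qed simp

lemma relpow_root:
  "v \<in> tree_verts c \<Longrightarrow>
    ([], v) \<in> tree_edges c ^^ length v \<and> (v, []) \<in> tree_edges c ^^ length v"
proof (induction v)
  case (Cons i v)
  hence v: "v \<in> tree_verts c" "i # v \<in> tree_verts c" by auto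
  note e = forest_edgesI[OF v, folded tree_edges_eq]
  show ?case using Cons.IH[OF v(1)] relpow_Suc_I2[OF e(2)] e(1) by auto
qed simp

lemma relpow_tree:
  assumes "x \<in> tree_verts c" "v \<in> tree_verts c"
  shows "(x, v) \<in> tree_edges c ^^ (length x + length v)"
  using relpow_root[OF assms(1)] relpow_root[OF assms(2)] unfolding relpow_add by blast

text \<open>Odd depths for winning and even depths for losing are exactly the certificates that
  never consult the declared level: at \<open>k = 0\<close> both claims are vacuous. They stay off
  the boundary and so hold for every \<open>\<sigma>\<close>.\<close>

lemma tree_certificate:
  assumes reg: "forest_region (tree_verts c) \<Psi>" and N: "{v \<in> tree_verts c. length v \<le> N} \<subseteq> \<Psi>"
    and v: "v \<in> tree_verts c" "length v + k \<le> N"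
  shows "(odd k \<longrightarrow> peel k (shift v c) \<longrightarrow> win (tree_verts c) \<Psi> \<sigma> v) \<and>
         (even k \<longrightarrow> \<not> peel k (shift v c) \<longrightarrow> lose (tree_verts c) \<Psi> \<sigma> v)"
  using v
proof (induction k arbitrary: v)
  case (Suc k)
  have vB: "v \<in> \<Psi> - boundary (forest_edges (tree_verts c)) \<Psi>"
    using N Suc.prems by (fastforce simp: boundary_def elim!: forest_edges_cases)
  have IH: "(odd k \<longrightarrow> peel k (shift (i # v) c) \<longrightarrow> win (tree_verts c) \<Psi> \<sigma> (i # v)) \<and>
         (even k \<longrightarrow> \<not> peel k (shift (i # v) c) \<longrightarrow> lose (tree_verts c) \<Psi> \<sigma> (i # v))" if "i < c v" for i
    using Suc.IH[of "i # v"] Suc.prems that by simp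
  have step: "peel (Suc k) (shift v c) \<longleftrightarrow> (\<forall>i<c v. \<not> peel k (shift (i # v) c))" by simp
  show ?case
  proof (intro conjI impI)
    assume "odd (Suc k)" "peel (Suc k) (shift v c)"
    thus "win (tree_verts c) \<Psi> \<sigma> v" using IH unfolding step by (intro win_inner[OF vB]) auto
  next
    assume "even (Suc k)" "\<not> peel (Suc k) (shift v c)"
    then obtain i where "i < c v" "win (tree_verts c) \<Psi> \<sigma> (i # v)" using IH unfolding step by auto
    thus "lose (tree_verts c) \<Psi> \<sigma> v" using Suc.prems(1) by (intro lose_inner[OF vB, of i]) auto
  qed
qed simp

section \<open>Weak spatial mixing from bounded dependency chains\<close>

inductive_set reach for c v where
  reach_refl: "v \<in> reach c v"
| reach_step: "u \<in> reach c v \<Longrightarrow> i < c u \<Longrightarrow> link (shift u c) i \<Longrightarrow> i # u \<in> reach c v"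

lemma finite_reach: "\<not> chain n (shift v c) \<Longrightarrow> finite (reach c v)"
proof (induction n arbitrary: v)
  case (Suc n)
  let ?C = "{i. i < c v \<and> link (shift v c) i}"
  have "finite (reach c (i # v))" if "i \<in> ?C" for i
    using Suc that by auto
  moreover have "reach c v \<subseteq> insert v (\<Union>i\<in>?C. reach c (i # v))"
  proof
    fix u assume "u \<in> reach c v"
    thus "u \<in> insert v (\<Union>i\<in>?C. reach c (i # v))"
      by induction (auto intro: reach_refl reach_step)
  qed
  ultimately show ?case by (auto intro: finite_subset)
qed simp

text \<open>All vertices up to depth \<open>m\<close> together with everything their links lead down
  to. The set is closed under parents and links, so edges leave it only downwards and are never
  links.\<close>

definition core :: "(nat list \<Rightarrow> nat) \<Rightarrow> nat \<Rightarrow> nat list set" where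
  "core c m = (\<Union>v\<in>{v \<in> tree_verts c. length v \<le> m}. reach c v)"

lemma reach_subset_tree: "u \<in> reach c v \<Longrightarrow> v \<in> tree_verts c \<Longrightarrow> u \<in> tree_verts c"
  by (induction rule: reach.induct) auto

lemma core_subset_tree: "core c m \<subseteq> tree_verts c"
  using reach_subset_tree by (auto simp: core_def)

lemma core_level: "v \<in> tree_verts c \<Longrightarrow> length v \<le> m \<Longrightarrow> v \<in> core c m"
  by (auto simp: core_def intro: reach_refl)

lemma core_link: "v \<in> core c m \<Longrightarrow> i < c v \<Longrightarrow> link (shift v c) i \<Longrightarrow> i # v \<in> core c m"
  by (auto simp: core_def intro: reach_step)

lemma core_parent:
  assumes "i # v \<in> core c m" shows "v \<in> core c m"
proof -
  obtain u where u: "u \<in> tree_verts c" "length u \<le> m" "i # v \<in> reach c u"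
    using assms by (auto simp: core_def)
  from u(3) show ?thesis
  proof cases
    case reach_refl
    thus ?thesis using u by (auto intro!: core_level)
  next
    case (reach_step)
    thus ?thesis using u by (auto simp: core_def)
  qed
qed

lemma finite_core:
  assumes "\<And>v. \<exists>n. \<not> chain n (shift v c)" shows "finite (core c m)"
  unfolding core_def using assms finite_reach finite_tree_levels by blast

locale determined_tree =
  fixes c :: "nat list \<Rightarrow> nat"
  assumes determined: "\<And>v. winning (shift v c) \<or> losing (shift v c)"
    and chains: "\<And>v. \<exists>n. \<not> chain n (shift v c)"
begin

abbreviation "T \<equiv> tree_verts c"
abbreviation "W v \<equiv> winning (shift v c)"
abbreviation "Crit v \<equiv> critical (shift v c)"

lemma W_child: "W v \<Longrightarrow> i < c v \<Longrightarrow> \<not> W (i # v)"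
  using winning_child_losing[of "shift v c" i] not_winning_losing[of "shift (i # v) c"] by auto

lemma not_W_child:
  assumes "\<not> W v" obtains i where "i < c v" "W (i # v)"
proof -
  have "\<exists>i<c v. \<not> losing (shift (i # v) c)" using assms winningI[of "shift v c"] by auto
  thus ?thesis using determined that by blast
qed

lemma Crit_iff: "Crit v \<longleftrightarrow> (\<exists>i<c v. W (i # v) \<and> (\<forall>j<c v. j \<noteq> i \<longrightarrow> \<not> W (j # v)))"
  by (simp add: critical_def)

lemma Crit_unique:
  assumes "Crit u" "i < c u" "j < c u" "W (i # u)" "W (j # u)" shows "i = j"
proof -
  obtain l where "\<forall>j<c u. j \<noteq> l \<longrightarrow> \<not> W (j # u)" using assms(1) unfolding Crit_iff by blast
  hence "i = l" "j = l" using assms(2-5) by blast+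
  thus ?thesis by simp
qed

lemma link_iff: "link (shift v c) i \<longleftrightarrow> Crit v \<and> (Crit (i # v) \<or> W (i # v)) \<or> W v \<and> Crit (i # v)"
  by (simp add: link_def)

lemma W_not_Crit: "W v \<Longrightarrow> \<not> Crit v"
  using winning_not_critical by blast

lemma two_W_children:
  assumes "\<not> W v" "\<not> Crit v"
  obtains i j where "i \<noteq> j" "i < c v" "j < c v" "W (i # v)" "W (j # v)"
  using not_W_child[OF assms(1)] assms(2) unfolding Crit_iff by metis

text \<open>The conditions mention neither a region nor a boundary condition; this is what makes the
  marginal on the core independent of both.\<close>

definition core_configs :: "nat \<Rightarrow> nat list set set" where
  "core_configs m = {J. J \<subseteq> core c m \<and> indep (tree_edges c) J \<and>
     (\<forall>v\<in>core c m. \<not> W v \<longrightarrow> \<not> Crit v \<longrightarrow> v \<notin> J) \<and>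
     (\<forall>v\<in>core c m. W v \<longrightarrow> (\<forall>i u. v = i # u \<longrightarrow> u \<notin> J) \<longrightarrow> v \<in> J)}"

lemma not_both_ends:
  assumes "indep (tree_edges c) J" "u \<in> J" "i # u \<in> J" "J \<subseteq> T" shows False
proof -
  have "(u, i # u) \<in> tree_edges c"
    unfolding tree_edges_eq by (rule forest_edgesI(1)) (use assms in auto)
  thus False using assms by (auto simp: indep_def)
qed

text \<open>
  Each critical vertex shares exactly one occupied place with its unique winning child, and every other
  winning vertex is occupied; so all core configurations have the same size and may be swapped
  inside a maximum configuration.
\<close>

lemma card_core_config:
  assumes J: "J \<in> core_configs m"
  shows "card J = card {v \<in> core c m. Crit v \<or> W v \<and> (\<forall>i u. v = i # u \<longrightarrow> \<not> Crit u)}"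
    (is "_ = card ?S")
proof (rule bij_betw_same_card)
  have JD: "J \<subseteq> core c m" and ind: "indep (tree_edges c) J"
    and neg: "\<And>v. v \<in> core c m \<Longrightarrow> \<not> W v \<Longrightarrow> \<not> Crit v \<Longrightarrow> v \<notin> J"
    and win: "\<And>v. v \<in> core c m \<Longrightarrow> W v \<Longrightarrow> (\<And>i u. v = i # u \<Longrightarrow> u \<notin> J) \<Longrightarrow> v \<in> J"
    using J unfolding core_configs_def by blast+
  have JT: "J \<subseteq> T" using JD core_subset_tree by blast
  note both = not_both_ends[OF ind _ _ JT]
  \<comment> \<open>\<open>\<phi>\<close> moves an occupied winning child to its critical parent and
    fixes all other vertices.\<close>
  define \<phi> where "\<phi> v = (if \<exists>i u. v = i # u \<and> W v \<and> Crit u then tl v else v)" for v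
  have \<phi>1: "\<phi> (i # u) = u" if "W (i # u)" "Crit u" for i u using that by (simp add: \<phi>_def)
  have \<phi>2: "\<phi> v = v" if "\<And>i u. v = i # u \<Longrightarrow> \<not> (W v \<and> Crit u)" for v
    using that by (auto simp: \<phi>_def)
  have cases: "(\<exists>i u. v = i # u \<and> W v \<and> Crit u \<and> \<phi> v = u) \<or>
      (\<forall>i u. v = i # u \<longrightarrow> \<not> (W v \<and> Crit u)) \<and> \<phi> v = v" for v
  proof (cases "\<exists>i u. v = i # u \<and> W v \<and> Crit u")
    case True
    thus ?thesis using \<phi>1 by blast
  next
    case False
    thus ?thesis using \<phi>2[of v] by blast
  qed
  show "bij_betw \<phi> J ?S"
    unfolding bij_betw_def
  proof
    show "inj_on \<phi> J"
    proof (rule inj_onI)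
      have moved: "x = y" if x: "x \<in> J" "x = i # u" "W x" "Crit u" and y: "y \<in> J" "\<phi> y = u" for x y i u
      proof -
        consider j where "y = j # u" "W y" | "y = u" using cases[of y] y(2) by metis
        thus ?thesis
        proof cases
          case 1
          have "i # u \<in> T" using subsetD[OF JT x(1)] unfolding x(2) .
          moreover have "j # u \<in> T" using subsetD[OF JT y(1)] unfolding 1(1) .
          ultimately have "i < c u" "j < c u" by simp_all
          moreover have "W (i # u)" "W (j # u)" using x(3) 1(2) unfolding x(2) 1(1) by blast+
          ultimately have "i = j" using Crit_unique[OF x(4)] by blast
          thus ?thesis unfolding x(2) 1(1) by simp
        next
          case 2
          have "i # u \<in> J" "u \<in> J" using x(1) y(1) unfolding x(2) 2 by blast+
          thus ?thesis using both by blast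
        qed
      qed
      fix x y assume xy: "x \<in> J" "y \<in> J" "\<phi> x = \<phi> y"
      show "x = y"
      proof (cases "\<exists>i u. x = i # u \<and> W x \<and> Crit u \<and> \<phi> x = u")
        case True
        then obtain i u where h: "x = i # u" "W x" "Crit u" "\<phi> x = u" by blast
        have "\<phi> y = u" using h(4) xy(3) by metis
        show ?thesis by (rule moved) fact+
      next
        case x: False
        show ?thesis
        proof (cases "\<exists>i u. y = i # u \<and> W y \<and> Crit u \<and> \<phi> y = u")
          case True
          then obtain i u where h: "y = i # u" "W y" "Crit u" "\<phi> y = u" by blast
          have "\<phi> x = u" using h(4) xy(3) by metis
          have "y = x" by (rule moved) fact+
          thus ?thesis by simp
        next
          case False
          hence "\<phi> x = x" "\<phi> y = y" using x cases by blast+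
          thus ?thesis using xy(3) by metis
        qed
      qed
    qed
    show "\<phi> ` J = ?S"
    proof (intro subset_antisym subsetI)
      fix s assume "s \<in> \<phi> ` J"
      then obtain v where v: "v \<in> J" "s = \<phi> v" by blast
      have vD: "v \<in> core c m" using v JD by blast
      from cases[of v] show "s \<in> ?S"
      proof (elim disjE conjE exE)
        fix i u assume h: "v = i # u" "Crit u" "\<phi> v = u"
        have "u \<in> core c m" using vD unfolding h(1) by (rule core_parent)
        thus ?thesis unfolding v(2) h(3) using h(2) by simp
      next
        assume "\<forall>i u. v = i # u \<longrightarrow> \<not> (W v \<and> Crit u)" "\<phi> v = v"
        thus ?thesis unfolding v(2) using v(1) vD neg[OF vD] by auto
      qed
    next
      fix s assume s: "s \<in> ?S"
      hence sD: "s \<in> core c m" by simp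
      show "s \<in> \<phi> ` J"
      proof (cases "Crit s")
        case True
        hence nW: "\<not> W s" using W_not_Crit by blast
        show ?thesis
        proof (cases "s \<in> J")
          case True
          thus ?thesis using \<phi>2[of s] nW by (metis rev_image_eqI)
        next
          case False
          obtain i where i: "i < c s" "W (i # s)" using not_W_child[OF nW] by blast
          \<comment> \<open>A critical vertex is linked to its winning child, so the child is in the
            core; with \<open>s\<close> vacant it must be occupied.\<close>
          have "i # s \<in> core c m" using core_link[OF sD i(1)] \<open>Crit s\<close> i(2) link_iff by blast
          hence "i # s \<in> J" by (rule win) (use i False in auto)
          thus ?thesis using \<phi>1[OF i(2) \<open>Crit s\<close>] by (metis rev_image_eqI)
        qed
      next
        case False
        hence Ws: "W s" and par: "\<And>i u. s = i # u \<Longrightarrow> \<not> Crit u" using s by auto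
        have "s \<in> J"
        proof (rule win[OF sD Ws])
          fix i u assume su: "s = i # u"
          have u: "u \<in> core c m" using sD su core_parent by blast
          have "i < c u" using subsetD[OF core_subset_tree sD] su by simp
          hence "\<not> W u" using W_child Ws su by blast
          thus "u \<notin> J" using neg[OF u] par[OF su] by blast
        qed
        thus ?thesis using \<phi>2[of s] par by (metis rev_image_eqI)
      qed
    qed
  qed
qed

text \<open>Maximum configurations restrict to core configurations, and any core configuration may
  be substituted: sizes agree and no edge out of the core creates a conflict. The radius
  \<open>N\<close> depends on the tree and \<open>m\<close> only.\<close>

lemma core_marginal:
  obtains N where "\<And>\<Psi> \<sigma>. finite \<Psi> \<Longrightarrow> \<Psi> \<subseteq> T \<Longrightarrow> {v \<in> T. length v \<le> N} \<subseteq> \<Psi> \<Longrightarrow>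
      boundary_condition (tree_edges c) \<Psi> \<sigma> \<Longrightarrow>
      map_pmf (\<lambda>I. I \<inter> core c m) (hc_measure (tree_edges c) \<Psi> \<sigma>) = pmf_of_set (core_configs m)"
proof -
  define D where "D = core c m"
  define ch where "ch A = (\<Union>v\<in>A. (\<lambda>i. i # v) ` {..<c v})" for A
  \<comment> \<open>Children of the core must be recognised as vacant, and this rests on
    certificates for their own children; hence two extra generations.\<close>
  define F where "F = D \<union> ch D \<union> ch (ch D)"
  have DT: "D \<subseteq> T" using core_subset_tree by (simp add: D_def)
  hence FT: "F \<subseteq> T" by (auto simp: F_def ch_def)
  have fin_ch: "finite (ch A)" if "finite A" for A using that by (simp add: ch_def)
  have finF: "finite F" using finite_core[OF chains] fin_ch by (simp add: F_def D_def)
  \<comment> \<open>The bound exceeds the depth strictly so that all of \<open>F\<close> ends up in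
    the interior of the region.\<close>
  have "\<exists>n. length v < n \<and> (W v \<longrightarrow> (\<exists>k. odd k \<and> peel k (shift v c) \<and> length v + k \<le> n))" for v
  proof (cases "W v")
    case True
    then obtain k where "peel (2 * k + 1) (shift v c)" unfolding winning_def by blast
    thus ?thesis
      by (intro exI[of _ "length v + (2 * k + 1)"] conjI impI exI[of _ "2 * k + 1"])
         (auto simp del: peel.simps)
  qed auto
  then obtain n where n: "\<And>v. length v < n v"
    "\<And>v. W v \<Longrightarrow> \<exists>k. odd k \<and> peel k (shift v c) \<and> length v + k \<le> n v" by metis
  define N where "N = (\<Sum>v\<in>F. n v)"
  have nN: "n v \<le> N" if "v \<in> F" for v unfolding N_def using finF that by (intro member_le_sum) auto
  show ?thesis
  proof (rule that[of N])
    fix \<Psi> \<sigma>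
    assume fin: "finite \<Psi>" and sub: "\<Psi> \<subseteq> T" and lev: "{v \<in> T. length v \<le> N} \<subseteq> \<Psi>"
      and bc: "boundary_condition (tree_edges c) \<Psi> \<sigma>"
    interpret forest_region T \<Psi> \<sigma> using fin sub by unfold_locales
    have winF: "win T \<Psi> \<sigma> v" if v: "v \<in> F" "W v" for v
    proof -
      obtain k where "odd k" "peel k (shift v c)" "length v + k \<le> n v" using n(2)[OF v(2)] by blast
      thus ?thesis
        using tree_certificate[OF forest_region_axioms lev, of v k \<sigma>] FT v(1) nN[OF v(1)] by auto
    qed
    have inner: "v \<in> \<Psi> - B" if v: "v \<in> F" for v
    proof -
      have "length v < N" using n(1)[of v] nN[OF v] by simp
      thus ?thesis using lev v FT by (fastforce simp: boundary_def elim!: forest_edges_cases)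
    qed
    have neg: "v \<notin> I" if v: "v \<in> D \<union> ch D" "\<not> W v" "\<not> Crit v" and I: "I \<in> M" for v I
    proof -
      obtain i j where ij: "i \<noteq> j" "i < c v" "j < c v" "W (i # v)" "W (j # v)"
        using two_W_children[OF v(2,3)] by blast
      have F: "v \<in> F" "i # v \<in> F" "j # v \<in> F" using v(1) ij by (auto simp: F_def ch_def)
      show ?thesis
        by (rule two_wins_notin_max[OF inner[OF F(1)] ij(1) _ _ winF[OF F(2) ij(4)] winF[OF F(3) ij(5)] I])
           (use F FT in auto)
    qed
    have MC: "I \<in> C" if "I \<in> M" for I using that by (simp add: hc_max_configs_def)
    have DF: "D \<subseteq> F" unfolding F_def by blast
    have restrict: "I \<inter> D \<in> core_configs m" if I: "I \<in> M" for I
      unfolding core_configs_def D_def[symmetric]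
    proof (intro CollectI conjI ballI impI)
      show "indep (tree_edges c) (I \<inter> D)"
        using MC[OF I] by (auto simp: hc_configs_def indep_def tree_edges_eq)
      fix v assume v: "v \<in> D"
      show "v \<notin> I \<inter> D" if "\<not> W v" "\<not> Crit v" using neg[of v I] v I that by blast
      show "v \<in> I \<inter> D" if w: "W v" and par: "\<forall>i u. v = i # u \<longrightarrow> u \<notin> I \<inter> D"
      proof -
        have "v \<in> I"
        proof (rule win_in_max[OF _ I])
          show "win T \<Psi> \<sigma> v" using winF DF v w by blast
          fix i u assume "v = i # u"
          thus "u \<notin> I" using par v core_parent by (auto simp: D_def)
        qed
        thus ?thesis using v by blast
      qed
    qed simp
    have exch: "(I - D) \<union> J \<in> M" if I: "I \<in> M" and J: "J \<in> core_configs m" for I J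
    proof -
      have JD: "J \<subseteq> D" and Jind: "indep (tree_edges c) J"
        and Jneg: "\<And>v. v \<in> D \<Longrightarrow> \<not> W v \<Longrightarrow> \<not> Crit v \<Longrightarrow> v \<notin> J"
        using J unfolding core_configs_def D_def by blast+
      \<comment> \<open>An edge out of the core goes down and is no link. As \<open>x\<close> is
        winning or critical, \<open>y\<close> is neither, and such a vertex is vacant in every
        maximum configuration.\<close>
      have cross: "(x, y) \<notin> E" if x: "x \<in> J" and y: "y \<in> I - D" for x y
      proof
        assume "(x, y) \<in> E"
        thus False
        proof (cases rule: forest_edges_cases)
          case (1 i)
          hence i: "i < c x" "y \<in> ch D" using x JD by (auto simp: ch_def)
          have xD: "x \<in> core c m" using x JD by (auto simp: D_def)
          have nl: "\<not> link (shift x c) i" using core_link[OF xD i(1)] y 1 by (auto simp: D_def)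
          have "W x \<or> Crit x" using Jneg x JD by blast
          hence "\<not> W y" "\<not> Crit y" using nl W_child[OF _ i(1)] unfolding link_iff 1 by blast+
          thus False using neg[of y I] i(2) I y by blast
        next
          case (2 i)
          thus False using x y JD core_parent by (auto simp: D_def)
        qed
      qed
      have cross': "(y, x) \<notin> E" if "x \<in> J" "y \<in> I - D" for x y
        using cross[OF that] by (auto simp: forest_edges_def)
      have IC: "I \<in> C" by (rule MC[OF I])
      have "indep E ((I - D) \<union> J)"
        using IC Jind cross cross' unfolding indep_def hc_configs_def tree_edges_eq by blast
      moreover have "J \<inter> B = {}" "D \<inter> B = {}" "J \<subseteq> \<Psi>" using JD DF inner by blast+
      ultimately have "(I - D) \<union> J \<in> C" using IC unfolding hc_configs_def by blast
      moreover have "card ((I - D) \<union> J) = card I"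
      proof -
        have fI: "finite I" by (rule config_finite[OF IC])
        have fJ: "finite J" using JD DF finF by (meson finite_subset)
        have "card ((I - D) \<union> J) = card (I - D) + card J"
          using fI fJ JD by (intro card_Un_disjoint) auto
        also have "card J = card (I \<inter> D)"
          using card_core_config[OF J] card_core_config[OF restrict[OF I]] by simp
        also have "card (I - D) + card (I \<inter> D) = card ((I - D) \<union> (I \<inter> D))"
          using fI by (intro card_Un_disjoint[symmetric]) auto
        also have "(I - D) \<union> (I \<inter> D) = I" by blast
        finally show ?thesis .
      qed
      ultimately show ?thesis using I by (simp add: hc_max_configs_def)
    qed
    show "map_pmf (\<lambda>I. I \<inter> core c m) (hc_measure (tree_edges c) \<Psi> \<sigma>) = pmf_of_set (core_configs m)"
      unfolding hc_measure_def tree_edges_eq D_def[symmetric]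
    proof (rule map_pmf_of_set_exchangeable)
      show "finite M" by (rule hc_max_configs_finite[OF fin])
      show "M \<noteq> {}" using hc_max_configs_nonempty[OF fin] bc by (simp add: tree_edges_eq)
      show "J \<subseteq> D" if "J \<in> core_configs m" for J using that by (simp add: core_configs_def D_def)
    qed (use restrict exch in blast)+
  qed
qed

text \<open>Once the region contains the ball of radius \<open>N\<close>, both marginals equal the
  same image of the uniform law on core configurations, so the distance is exactly 0.\<close>

lemma WSM_determined: "WSM T (tree_edges c)"
  unfolding WSM_def
proof (intro allI impI, elim conjE)
  fix \<Lambda> :: "nat list set" and \<Psi> \<sigma> \<tau> :: "nat \<Rightarrow> nat list set"
  assume \<Lambda>: "finite \<Lambda>" "\<Lambda> \<subseteq> T"
    and h: "\<forall>n. finite (\<Psi> n) \<and> \<Psi> n \<subseteq> T \<and> \<Lambda> \<subseteq> \<Psi> n \<and>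
      boundary_condition (tree_edges c) (\<Psi> n) (\<sigma> n) \<and> boundary_condition (tree_edges c) (\<Psi> n) (\<tau> n)"
    and dist: "(\<lambda>n. set_gdist (tree_edges c) \<Lambda> (boundary (tree_edges c) (\<Psi> n))) \<longlonglongrightarrow> \<infinity>"
  let ?E = "tree_edges c"
  let ?tv = "\<lambda>n. tv_dist (marginal \<Lambda> (hc_measure ?E (\<Psi> n) (\<sigma> n)))
                       (marginal \<Lambda> (hc_measure ?E (\<Psi> n) (\<tau> n)))"
  show "?tv \<longlonglongrightarrow> 0"
  proof (cases "\<Lambda> = {}")
    case True
    thus ?thesis by (simp add: marginal_def map_pmf_const tv_dist_self)
  next
    case False
    then obtain x where x: "x \<in> \<Lambda>" by blast
    define m where "m = (\<Sum>v\<in>\<Lambda>. length v)"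
    have \<Lambda>D: "\<Lambda> \<subseteq> core c m"
    proof
      fix v assume v: "v \<in> \<Lambda>"
      have "length v \<le> m" unfolding m_def using \<Lambda>(1) v by (intro member_le_sum) auto
      thus "v \<in> core c m" using v \<Lambda>(2) by (intro core_level) auto
    qed
    obtain N where N: "\<And>\<Psi> \<sigma>. finite \<Psi> \<Longrightarrow> \<Psi> \<subseteq> T \<Longrightarrow> {v \<in> T. length v \<le> N} \<subseteq> \<Psi> \<Longrightarrow>
      boundary_condition ?E \<Psi> \<sigma> \<Longrightarrow>
      map_pmf (\<lambda>I. I \<inter> core c m) (hc_measure ?E \<Psi> \<sigma>) = pmf_of_set (core_configs m)"
      using core_marginal[of m] by blast
    have marg: "marginal \<Lambda> p = map_pmf (\<lambda>I. I \<inter> \<Lambda>) (map_pmf (\<lambda>I. I \<inter> core c m) p)" for p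
    proof -
      have "I \<inter> core c m \<inter> \<Lambda> = I \<inter> \<Lambda>" for I using \<Lambda>D by blast
      thus ?thesis by (simp add: marginal_def map_pmf_comp)
    qed
    have "enat (length x + N) < \<infinity>" by simp
    from order_tendstoD(1)[OF dist this] have "\<forall>\<^sub>F n in sequentially. ?tv n = 0"
    proof eventually_elim
      case (elim n)
      have "{v \<in> T. length v \<le> N} \<subseteq> \<Psi> n"
      proof (rule ccontr)
        assume "\<not> {v \<in> T. length v \<le> N} \<subseteq> \<Psi> n"
        then obtain v where v: "v \<in> T" "length v \<le> N" "v \<notin> \<Psi> n" by blast
        \<comment> \<open>The walk from \<open>x\<close> to a missing vertex \<open>v\<close>
          through the root would meet the boundary within \<open>length x + N\<close> steps.\<close>
        have "(x, v) \<in> ?E ^^ (length x + length v)" "x \<in> \<Psi> n"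
          using relpow_tree x \<Lambda>(2) v(1) h by blast+
        from relpow_exit[OF this v(3)] obtain j y where j: "j \<le> length x + length v"
          "y \<in> boundary ?E (\<Psi> n)" "(x, y) \<in> ?E ^^ j" by blast
        have "set_gdist ?E \<Lambda> (boundary ?E (\<Psi> n)) \<le> enat j"
          unfolding set_gdist_def by (rule INF_lower) (use x j in blast)
        also have "\<dots> \<le> enat (length x + N)" using j v by simp
        finally show False using elim by simp
      qed
      thus ?case using N[of "\<Psi> n"] h by (simp add: marg tv_dist_self)
    qed
    thus ?thesis by (rule tendsto_eventually)
  qed
qed

end

section \<open>The lower and the upper bound on the threshold\<close>

lemma WSM_not_SSM_below:
  assumes "0 < d" "d < exp (1 / sqrt 2) / sqrt 2" shows "WSM_not_SSM_as d"
proof -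
  interpret poisson_gw d using assms by unfold_locales
  have "d < exp 1" using assms critical_value_less_e by linarith
  from AE_shift[OF AE_determined[OF this]] AE_shift[OF AE_chain_terminates[OF assms(2)]]
    AE_infinite_branching
  have "AE c in P. infinite (tree_verts c) \<longrightarrow>
      WSM (tree_verts c) (tree_edges c) \<and> \<not> SSM (tree_verts c) (tree_edges c)"
  proof eventually_elim
    case (elim c)
    then interpret determined_tree c by unfold_locales auto
    show ?case using WSM_determined elim(3) not_SSM_branching by blast
  qed
  moreover have "{c. infinite (tree_verts c)} \<in> sets P"
    using pred_sets[OF pred_intros_logic(2)[OF measurable_finite_tree]] by simp
  ultimately show ?thesis
    unfolding WSM_not_SSM_as_def infinite_poisson_tree_def
    by (intro AE_uniform_measureI) auto
qed

lemma not_WSM_above: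
  assumes "d > exp 1" shows "\<not> WSM_not_SSM_as d"
proof
  assume as: "WSM_not_SSM_as d"
  interpret poisson_gw d using assms exp_gt_zero[of "1::real"] by unfold_locales linarith
  let ?G = "{c. c [] = 2 \<and> (\<forall>i<2. \<not> winning (shift [i] c) \<and> \<not> losing (shift [i] c))}"
  let ?I = "{c. infinite (tree_verts c)}"
  have I: "?I \<in> sets P"
    using pred_sets[OF pred_intros_logic(2)[OF measurable_finite_tree]] by simp
  have "c \<in> ?I" if "c \<in> ?G" for c
  proof -
    have "infinite (tree_verts (shift [0] c))"
      using that finite_tree_determined[of "shift [0] c"] by auto
    thus ?thesis using that finite_tree_iff[of c] by auto
  qed
  hence GI: "?G \<subseteq> ?I" by blast
  have "0 < P.prob ?G" by (rule prob_two_undetermined[OF assms])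
  also have "\<dots> \<le> P.prob ?I" by (rule P.finite_measure_mono[OF GI I])
  finally have "emeasure P ?I \<noteq> 0" by (simp add: P.emeasure_eq_measure)
  hence "AE c in P. c \<in> ?I \<longrightarrow> WSM (tree_verts c) (tree_edges c)"
    using as I AE_uniform_measure[of P ?I "\<lambda>c. WSM (tree_verts c) (tree_edges c)"]
    unfolding WSM_not_SSM_as_def infinite_poisson_tree_def
    by (auto simp: P.emeasure_eq_measure elim: eventually_mono)
  hence "AE c in P. c \<notin> ?G"
    by eventually_elim (use GI not_WSM_undetermined in blast)
  \<comment> \<open>Measurability of \<open>?G\<close> comes for free: a set outside the
    sigma-algebra has \<open>measure\<close> 0, whereas \<open>?G\<close> has positive
    probability.\<close>
  hence "P.prob ?G = 0"
    using \<open>0 < P.prob ?G\<close> P.prob_eq_0 measure_notin_sets by fastforce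
  thus False using \<open>0 < P.prob ?G\<close> by simp
qed

theorem theorem1p3:
  shows "\<exists>dstar::real.
           dstar > 1 \<and>
           (\<forall>d. 1 < d \<and> d < dstar \<longrightarrow> WSM_not_SSM_as d) \<and>
           (\<forall>d'. d' > 1 \<and> (\<forall>d. 1 < d \<and> d < d' \<longrightarrow> WSM_not_SSM_as d) \<longrightarrow> d' \<le> dstar) \<and>
           exp (1 / sqrt 2) / sqrt 2 \<le> dstar \<and> dstar \<le> exp 1"
proof -
  let ?v = "exp (1 / sqrt 2) / sqrt 2 :: real"
  \<comment> \<open>The required constant is the supremum of \<open>?S\<close>: any \<open>d\<close>
    below it lies below some member, so the supremum itself has the defining property.\<close>
  let ?S = "{d'. d' > 1 \<and> (\<forall>d. 1 < d \<and> d < d' \<longrightarrow> WSM_not_SSM_as d)}"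
  have "1 < ?v"
  proof -
    \<comment> \<open>The claim amounts to \<open>sqrt 2 < exp (1 / sqrt 2)\<close>, for which the
      tangent bound \<open>1 + 1 / sqrt 2\<close> is already large enough.\<close>
    have "1 / sqrt 2 = sqrt 2 / (2::real)" by (simp add: field_simps)
    moreover have "sqrt 2 < (2::real)" by (rule real_less_lsqrt) auto
    ultimately have "sqrt 2 < 1 + 1 / sqrt (2::real)" by linarith
    also have "\<dots> \<le> exp (1 / sqrt 2)" by (rule exp_ge_add_one_self)
    finally show ?thesis by (simp add: less_divide_eq)
  qed
  hence vS: "?v \<in> ?S" using WSM_not_SSM_below by auto
  have le: "d' \<le> exp 1" if "d' \<in> ?S" for d'
  proof (rule ccontr)
    assume "\<not> d' \<le> exp 1"
    then obtain d where d: "exp 1 < d" "d < d'" using dense by (metis not_le)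
    hence "1 < d" using exp_gt_one[of 1] by linarith
    thus False using not_WSM_above[OF d(1)] that d(2) by blast
  qed
  have bdd: "bdd_above ?S" using le by (intro bdd_aboveI)
  have up: "d' \<le> Sup ?S" if "d' \<in> ?S" for d' using cSup_upper[OF that bdd] .
  have "WSM_not_SSM_as d" if d: "1 < d" "d < Sup ?S" for d
  proof -
    obtain d' where "d' \<in> ?S" "d < d'" using less_cSupD[OF _ d(2)] vS by blast
    thus ?thesis using d(1) by blast
  qed
  moreover have "Sup ?S \<le> exp 1" by (rule cSup_least[OF _ le]) (use vS in blast)
  moreover have "1 < Sup ?S" using \<open>1 < ?v\<close> up[OF vS] by linarith
  ultimately show ?thesis using up vS by (intro exI[of _ "Sup ?S"]) auto
qed

end
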